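(* (Nonzero surface tension, Burgers case.) Let $\alpha>0$ and take exponents $\beta=q=k=\alpha$. Let $P_0,R_0,T_0>0$, $\sigma'\ge0$, $\gamma>1$, $0<X<1$ be constants, $s=R_0^3-X+1$, $\rho_0=1/s$, $P_{20}=P_0+2\sigma'/R_0$, and $$a_0=\frac{(9R_0P_0+12\sigma')^{1/2}s}{3R_0^2}.$$ Let $\rho^{(1)}(\xi,\tau)$ be an arbitrary smooth solution of the Burgers equation $\rho^{(1)}_\tau=A\rho^{(1)}_{\xi\xi}+B\rho^{(1)}\rho^{(1)}_\xi$ with $$A=\frac{\left(P_0^2R_0^5+R_0^4\left(4P_0\sigma'+\frac{13}{3}T_0\right)+4R_0^3\sigma'^2+\left[(P_0R_0+2\sigma')^2+\frac43R_0T_0\right](1-X)\right)s}{6R_0^4T_0},$$ $$B=-3^{1/2}\frac{s^3}{(3P_0R_0+4\sigma')^{1/2}R_0^5}\left(P_0R_0+\tfrac{14}{9}\sigma'\right).$$ Let $$u^{(1)}=\frac{a_0}{\rho_0}\rho^{(1)},\quad R^{(1)}=-\frac{s^2}{3R_0^2}\rho^{(1)},\quad P_2^{(1)}=-\frac{3(P_0R_0+2\sigma')}{R_0^2}R^{(1)},\quad P^{(1)}=P_2^{(1)}+\frac{2\sigma'}{R_0^2}R^{(1)},$$ and let $\rho^{(2)}(\xi,\tau)$ be smooth. Then there exist smooth functions $u^{(2)},P^{(2)},P_2^{(2)},R^{(2)}$ of $(\xi,\tau)$ such that for the truncated expansions $$\rho=\rho_0+\epsilon^q\rho^{(1)}+\epsilon^{q+k}\rho^{(2)},\quad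 u=\epsilon^qu^{(1)}+\epsilon^{q+k}u^{(2)},\quad R=R_0+\epsilon^qR^{(1)}+\epsilon^{q+k}R^{(2)},$$ $$P=P_0+\epsilon^qP^{(1)}+\epsilon^{q+k}P^{(2)},\quad P_2=P_{20}+\epsilon^qP_2^{(1)}+\epsilon^{q+k}P_2^{(2)}$$ the following holds for each fixed $(\xi,\tau)$ as $\epsilon\to0^+$: the coefficients of $\epsilon^{\alpha+q}$ and $\epsilon^{\alpha+q+k}$ in the residuals $E_1,E_2$ and of $\epsilon^q$ and $\epsilon^{q+k}$ in $E_3,E_4,E_5$ vanish, so that $E_1,E_2=O(\epsilon^{4\alpha})$ and $E_3,E_4,E_5=O(\epsilon^{3\alpha})$.
   Context: Residuals of the dimensionless one-dimensional bubbly fluid system with bubble surface tension parameter $\sigma'$ (no gravity), with $\mathcal{D}_t=\partial_t+u\partial_x$: $$E_1=\rho_t+(\rho u)_x,\qquad E_2=(\rho u)_t+(\rho u^2+P)_x-u_{xx},$$ $$E_3=P-P_2+R\,\mathcal{D}_t^2R+\tfrac32(\mathcal{D}_tR)^2+\tfrac43\frac{\mathcal{D}_tR}{R}+\frac{2\sigma'}{R},$$ $$E_4=\mathcal{D}_tP_2+3\gamma P_2\frac{\mathcal{D}_tR}{R}+3(\gamma-1)\frac{T_0}{R}\left(\frac{P_2R^3}{P_{20}R_0^3}-1\right),\qquad E_5=(1-X+R^3)\rho-1.$$ Here $P_{20}=P_0+2\sigma'/R_0$ is the equilibrium (initial) gas pressure. Gardner–Morikawa variables: $\xi=\epsilon^\alpha(x-a_0t)$,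 $\tau=\epsilon^{\alpha+\beta}t$, so that on functions of $(\xi,\tau)$ one has $\partial_x=\epsilon^\alpha\partial_\xi$, $\partial_t=-a_0\epsilon^\alpha\partial_\xi+\epsilon^{\alpha+\beta}\partial_\tau$. All coefficient functions are smooth functions of $(\xi,\tau)\in\mathbb{R}\times J$, $J$ an open interval; subscripts $\xi,\tau$ denote partial derivatives. *)

theory Defs
  imports "HOL-Analysis.Analysis"
begin

text \<open>A field is a curried function of a space-like and a time-like variable, used both for
  \<open>(x, t)\<close> and for \<open>(\<xi>, \<tau>)\<close>.\<close>

type_synonym field2 = "real \<Rightarrow> real \<Rightarrow> real"

definition pd1 :: "field2 \<Rightarrow> field2" where
  "pd1 f = (\<lambda>x t. deriv (\<lambda>y. f y t) x)"

definition pd2 :: "field2 \<Rightarrow> field2" where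
  "pd2 f = (\<lambda>x t. deriv (\<lambda>s. f x s) t)"

text \<open>For open \<open>J\<close>, \<open>Ck_strip k f J\<close> says that all iterated partial derivatives of \<open>f\<close> up to
  order \<open>k\<close>, in any order, exist and are jointly continuous on \<open>\<real> \<times> J\<close>.\<close>

primrec Ck_strip :: "nat \<Rightarrow> field2 \<Rightarrow> real set \<Rightarrow> bool" where
  "Ck_strip 0 f J \<longleftrightarrow> continuous_on (UNIV \<times> J) (\<lambda>(x, t). f x t)"
| "Ck_strip (Suc k) f J \<longleftrightarrow>
     continuous_on (UNIV \<times> J) (\<lambda>(x, t). f x t) \<and>
     (\<forall>x. \<forall>t\<in>J. (\<lambda>y. f y t) differentiable (at x) \<and> (\<lambda>s. f x s) differentiable (at t)) \<and>
     Ck_strip k (pd1 f) J \<and> Ck_strip k (pd2 f) J"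

definition smooth_strip :: "field2 \<Rightarrow> real set \<Rightarrow> bool" where
  "smooth_strip f J \<longleftrightarrow> (\<forall>k. Ck_strip k f J)"


subsection \<open>Residuals in the physical variables \<open>(x, t)\<close>\<close>

definition material_deriv :: "field2 \<Rightarrow> field2 \<Rightarrow> field2" where
  "material_deriv u f = (\<lambda>x t. pd2 f x t + u x t * pd1 f x t)"

definition E1 :: "field2 \<Rightarrow> field2 \<Rightarrow> field2" where
  "E1 \<rho> u = (\<lambda>x t. pd2 \<rho> x t + pd1 (\<lambda>x t. \<rho> x t * u x t) x t)"

definition E2 :: "field2 \<Rightarrow> field2 \<Rightarrow> field2 \<Rightarrow> field2" where
  "E2 \<rho> u P = (\<lambda>x t. pd2 (\<lambda>x t. \<rho> x t * u x t) x t
     + pd1 (\<lambda>x t. \<rho> x t * (u x t)\<^sup>2 + P x t) x t - pd1 (pd1 u) x t)"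

definition E3 :: "real \<Rightarrow> field2 \<Rightarrow> field2 \<Rightarrow> field2 \<Rightarrow> field2 \<Rightarrow> field2" where
  "E3 \<sigma> u P P2 R = (\<lambda>x t. P x t - P2 x t
     + R x t * material_deriv u (material_deriv u R) x t
     + 3/2 * (material_deriv u R x t)\<^sup>2
     + 4/3 * (material_deriv u R x t / R x t)
     + 2 * \<sigma> / R x t)"

definition E4 :: "real \<Rightarrow> real \<Rightarrow> real \<Rightarrow> real \<Rightarrow> field2 \<Rightarrow> field2 \<Rightarrow> field2 \<Rightarrow> field2" where
  "E4 \<gamma> T0 P20 R0 u P2 R = (\<lambda>x t. material_deriv u P2 x t
     + 3 * \<gamma> * P2 x t * (material_deriv u R x t / R x t)
     + 3 * (\<gamma> - 1) * (T0 / R x t) * (P2 x t * (R x t)^3 / (P20 * R0^3) - 1))"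

definition E5 :: "real \<Rightarrow> field2 \<Rightarrow> field2 \<Rightarrow> field2" where
  "E5 X \<rho> R = (\<lambda>x t. (1 - X + (R x t)^3) * \<rho> x t - 1)"


subsection \<open>Gardner--Morikawa variables and truncated expansions\<close>

text \<open>\<open>gm_pull\<close> turns a function of \<open>(\<xi>, \<tau>)\<close> into a function of \<open>(x, t)\<close> by substituting
  \<open>\<xi> = \<epsilon>\<^sup>\<alpha> (x - a0 t)\<close>, \<open>\<tau> = \<epsilon>\<^sup>\<alpha>\<^sup>+\<^sup>\<beta> t\<close>; \<open>gm_at\<close> re-expresses a function of \<open>(x, t)\<close> in
  \<open>(\<xi>, \<tau>)\<close>, for \<open>\<epsilon> > 0\<close>, by the inverse substitution.\<close>

definition gm_pull :: "real \<Rightarrow> real \<Rightarrow> real \<Rightarrow> real \<Rightarrow> field2 \<Rightarrow> field2" where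
  "gm_pull \<alpha> \<beta> a0 \<epsilon> f =
     (\<lambda>x t. f (\<epsilon> powr \<alpha> * (x - a0 * t)) (\<epsilon> powr (\<alpha> + \<beta>) * t))"

definition gm_at :: "real \<Rightarrow> real \<Rightarrow> real \<Rightarrow> real \<Rightarrow> field2 \<Rightarrow> field2" where
  "gm_at \<alpha> \<beta> a0 \<epsilon> g =
     (\<lambda>\<xi> \<tau>. g (\<xi> / \<epsilon> powr \<alpha> + a0 * (\<tau> / \<epsilon> powr (\<alpha> + \<beta>))) (\<tau> / \<epsilon> powr (\<alpha> + \<beta>)))"

definition trunc2 :: "real \<Rightarrow> real \<Rightarrow> real \<Rightarrow> real \<Rightarrow> field2 \<Rightarrow> field2 \<Rightarrow> field2" where
  "trunc2 q k \<epsilon> c f1 f2 =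
     (\<lambda>\<xi> \<tau>. c + \<epsilon> powr q * f1 \<xi> \<tau> + \<epsilon> powr (q + k) * f2 \<xi> \<tau>)"


subsection \<open>Coefficients of powers of \<open>\<epsilon>\<close>\<close>

text \<open>\<open>eps_series \<alpha> f F\<close>: for small \<open>\<epsilon> > 0\<close>, \<open>f \<epsilon>\<close> is the sum of the convergent series
  \<open>\<Sum>n. F $ n * \<epsilon>\<^sup>n\<^sup>\<alpha>\<close>.  Such an \<open>F\<close> is unique when \<open>\<alpha> > 0\<close>, and \<open>F $ n\<close> is then the
  coefficient of \<open>\<epsilon>\<^sup>n\<^sup>\<alpha>\<close> in \<open>f\<close>.\<close>

definition eps_series :: "real \<Rightarrow> (real \<Rightarrow> real) \<Rightarrow> real fps \<Rightarrow> bool" where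
  "eps_series \<alpha> f F \<longleftrightarrow> fps_conv_radius F > 0 \<and>
     (\<forall>\<^sub>F \<epsilon> in at_right 0. f \<epsilon> = eval_fps F (\<epsilon> powr \<alpha>))"

text \<open>The exponents in \<open>S\<close> are meant to be multiples of \<open>\<alpha>\<close>.\<close>

definition eps_coeffs_vanish :: "real \<Rightarrow> (real \<Rightarrow> real) \<Rightarrow> real set \<Rightarrow> bool" where
  "eps_coeffs_vanish \<alpha> f S \<longleftrightarrow>
     (\<exists>F. eps_series \<alpha> f F \<and> (\<forall>n. real n * \<alpha> \<in> S \<longrightarrow> fps_nth F n = 0))"

end

(* With delta = eps^alpha every field becomes a function of (xi, tau) whose value at a fixed point
   is a polynomial in delta, and d/dx, d/dt become delta d/dxi and -a0 delta d/dxi + delta^2 d/dtau.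
   So each residual is a polynomial in delta, divided by R in E3 and E4, and only its lowest
   coefficients matter.  At the leading order they vanish because a0 is the sound speed.  At the
   next order E1 is an exact xi-derivative once the Burgers equation is used, so that E1, E2, E5
   and E3 are solved successively for u2, P2, R2 and P22; each has the form
   a * rho2 + b * rho1_xi + c * rho1^2.  In the remaining equation E4 the rho2 terms cancel, and the
   coefficients of rho1_xi and rho1^2 vanish by the choice of A and B respectively. *)

theory Submission
  imports Defs
begin

subsection \<open>Smooth functions on a strip\<close>

text \<open>Three dissipative effects meet at the second order, and each supplies one summand of
  \<open>2 * A\<close> in \<open>two_A\<close>: the viscous term u_xx of E2 gives \<open>s\<close>,
  the damping term (4/3) D_t R / R of E3 gives \<open>4 * s^2 / (9 * R0^3)\<close>, and the heat
  exchange in E4 gives \<open>P20^2 * s^2 / (3 * R0^2 * T0)\<close>. The bubble inertia R D_t^2 R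
  starts at delta^3, because each material derivative brings one power of delta and the nonconstant
  part of R another; so no third xi-derivative appears and the limit equation is Burgers. The
  constant \<open>\<gamma>\<close> is absent from A and B because the lowest order of E4 makes P_2
  R^3 constant up to that order, which turns the transport terms of E4 into a multiple of
  \<open>\<gamma> - 1\<close>, the factor of the heat term. The analytic obstacle is that the fields
  are controlled only for tau in J, while \<open>deriv\<close> is total: identities between
  derivatives are available on an open set only, and a change of t moves xi and tau together, so the
  chain rule needs the total derivative and not just the two partial ones.\<close>

lemma pd2_cong_strip:
  assumes "open J" "t \<in> J" "\<And>t. t \<in> J \<Longrightarrow> f x t = g x t"
  shows "pd2 f x t = pd2 g x t"
  unfolding pd2_def
  using assms by (intro deriv_cong_ev refl) (auto elim!: eventually_mono[OF eventually_nhds_in_open])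

lemma pd1_cong_strip:
  assumes "\<And>x. f x t = g x t"
  shows "pd1 f x t = pd1 g x t"
  using assms by (simp add: pd1_def)

text \<open>Sum and product rules hold only over J, so the formula for a derivative and the
  derivative itself may differ elsewhere. Openness of J lets agreement over J survive
  differentiation in t, which is what the induction needs.\<close>

lemma Ck_strip_cong:
  assumes "open J" "\<And>x t. t \<in> J \<Longrightarrow> f x t = g x t" "Ck_strip k f J"
  shows "Ck_strip k g J"
  using assms(2,3)
proof (induction k arbitrary: f g)
  case 0
  have "continuous_on (UNIV \<times> J) (\<lambda>(x, t). f x t) = continuous_on (UNIV \<times> J) (\<lambda>(x, t). g x t)"
    using 0 by (intro continuous_on_cong) auto
  with 0 show ?case by simp
next
  case (Suc k)
  have "continuous_on (UNIV \<times> J) (\<lambda>(x, t). f x t) = continuous_on (UNIV \<times> J) (\<lambda>(x, t). g x t)"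
    using Suc.prems by (intro continuous_on_cong) auto
  moreover have "(\<lambda>s. g x s) differentiable (at t)" if "t \<in> J" for x t
  proof -
    from Suc.prems that obtain D where "((\<lambda>s. f x s) has_derivative D) (at t)"
      unfolding differentiable_def Ck_strip.simps by blast
    then have "((\<lambda>s. g x s) has_derivative D) (at t)"
      by (rule has_derivative_transform_within_open[OF _ assms(1) that]) (simp add: Suc.prems(1))
    then show ?thesis by (auto simp: differentiable_def)
  qed
  moreover have "Ck_strip k (pd1 g) J"
    by (rule Suc.IH[of "pd1 f"], rule pd1_cong_strip) (use Suc.prems in auto)
  moreover have "Ck_strip k (pd2 g) J"
    by (rule Suc.IH[of "pd2 f"], rule pd2_cong_strip[OF assms(1)]) (use Suc.prems in auto)
  moreover have "(\<lambda>y. g y t) = (\<lambda>y. f y t)" if "t \<in> J" for t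
    using Suc.prems that by auto
  ultimately show ?case using Suc.prems by simp
qed

lemma Ck_strip_Suc_imp: "Ck_strip (Suc k) f J \<Longrightarrow> Ck_strip k f J"
proof (induction k arbitrary: f)
  case (Suc k)
  then show ?case
    unfolding Ck_strip.simps(2)[of "Suc k" f] Ck_strip.simps(2)[of k f] by blast
qed simp

lemma smooth_strip_pd:
  assumes "smooth_strip f J"
  shows "smooth_strip (pd1 f) J" "smooth_strip (pd2 f) J"
  using assms unfolding smooth_strip_def by (metis Ck_strip.simps(2))+

lemma Ck_strip_DERIV:
  assumes "Ck_strip (Suc k) f J" "t \<in> J"
  shows "((\<lambda>y. f y t) has_field_derivative pd1 f x t) (at x)"
    and "((\<lambda>s. f x s) has_field_derivative pd2 f x t) (at t)"
  using assms by (auto simp: pd1_def pd2_def DERIV_deriv_iff_real_differentiable)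

lemma smooth_strip_DERIV:
  assumes "smooth_strip f J" "t \<in> J"
  shows "((\<lambda>y. f y t) has_field_derivative pd1 f x t) (at x)"
    and "((\<lambda>s. f x s) has_field_derivative pd2 f x t) (at t)"
  using assms Ck_strip_DERIV[of 0 f J t] unfolding smooth_strip_def by blast+

lemma pd1_eqI: "((\<lambda>y. f y t) has_field_derivative D) (at x) \<Longrightarrow> pd1 f x t = D"
  by (simp add: pd1_def DERIV_imp_deriv)

lemma pd2_eqI: "((\<lambda>s. f x s) has_field_derivative D) (at t) \<Longrightarrow> pd2 f x t = D"
  by (simp add: pd2_def DERIV_imp_deriv)

lemma Ck_strip_const: "Ck_strip k (\<lambda>x t. c) J"
proof (induction k arbitrary: c)
  case (Suc k)
  have "pd1 (\<lambda>x t. c) = (\<lambda>x t. 0)" "pd2 (\<lambda>x t. c) = (\<lambda>x t. 0)"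
    by (auto simp: pd1_def pd2_def)
  with Suc show ?case by simp
qed simp

lemma Ck_strip_add:
  assumes "open J" "Ck_strip k f J" "Ck_strip k g J"
  shows "Ck_strip k (\<lambda>x t. f x t + g x t) J"
  using assms(2,3)
proof (induction k arbitrary: f g)
  case 0
  then show ?case by (simp add: split_beta' continuous_on_add continuous_on_mult)
next
  case (Suc k)
  note D = Ck_strip_DERIV[OF Suc.prems(1)] Ck_strip_DERIV[OF Suc.prems(2)]
  have *: "Ck_strip k (\<lambda>x t. pd1 f x t + pd1 g x t) J"
    "Ck_strip k (\<lambda>x t. pd2 f x t + pd2 g x t) J"
    using Suc.prems by (simp_all add: Suc.IH)
  have "Ck_strip k (pd1 (\<lambda>x t. f x t + g x t)) J"
    by (rule Ck_strip_cong[OF assms(1) _ *(1)]) (rule pd1_eqI[symmetric], rule DERIV_add; rule D)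
  moreover have "Ck_strip k (pd2 (\<lambda>x t. f x t + g x t)) J"
    by (rule Ck_strip_cong[OF assms(1) _ *(2)]) (rule pd2_eqI[symmetric], rule DERIV_add; rule D)
  ultimately show ?case
    using Suc.prems by (simp add: split_beta' continuous_on_add continuous_on_mult)
qed

lemma Ck_strip_mult:
  assumes "open J" "Ck_strip k f J" "Ck_strip k g J"
  shows "Ck_strip k (\<lambda>x t. f x t * g x t) J"
  using assms(2,3)
proof (induction k arbitrary: f g)
  case 0
  then show ?case by (simp add: split_beta' continuous_on_add continuous_on_mult)
next
  case (Suc k)
  note D = Ck_strip_DERIV[OF Suc.prems(1)] Ck_strip_DERIV[OF Suc.prems(2)]
  \<comment> \<open>The product rule leaves one factor undifferentiated; its order has to be lowered
    from k + 1 to k before the induction hypothesis applies.\<close>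
  note S = Suc.prems[THEN Ck_strip_Suc_imp]
  have *: "Ck_strip k (\<lambda>x t. pd1 f x t * g x t + pd1 g x t * f x t) J"
    "Ck_strip k (\<lambda>x t. pd2 f x t * g x t + pd2 g x t * f x t) J"
    using Suc.prems S by (simp_all add: Ck_strip_add[OF assms(1)] Suc.IH)
  have "Ck_strip k (pd1 (\<lambda>x t. f x t * g x t)) J"
    by (rule Ck_strip_cong[OF assms(1) _ *(1)]) (rule pd1_eqI[symmetric], rule DERIV_mult; rule D)
  moreover have "Ck_strip k (pd2 (\<lambda>x t. f x t * g x t)) J"
    by (rule Ck_strip_cong[OF assms(1) _ *(2)]) (rule pd2_eqI[symmetric], rule DERIV_mult; rule D)
  ultimately show ?case
    using Suc.prems by (simp add: split_beta' continuous_on_add continuous_on_mult)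
qed

lemma smooth_strip_const: "smooth_strip (\<lambda>x t. c) J"
  by (simp add: smooth_strip_def Ck_strip_const)

lemma smooth_strip_add:
  "open J \<Longrightarrow> smooth_strip f J \<Longrightarrow> smooth_strip g J \<Longrightarrow> smooth_strip (\<lambda>x t. f x t + g x t) J"
  by (simp add: smooth_strip_def Ck_strip_add)

lemma smooth_strip_mult:
  "open J \<Longrightarrow> smooth_strip f J \<Longrightarrow> smooth_strip g J \<Longrightarrow> smooth_strip (\<lambda>x t. f x t * g x t) J"
  by (simp add: smooth_strip_def Ck_strip_mult)

lemma smooth_strip_power:
  "open J \<Longrightarrow> smooth_strip f J \<Longrightarrow> smooth_strip (\<lambda>x t. f x t ^ n) J"
  by (induction n) (auto intro: smooth_strip_const smooth_strip_mult)

text \<open>Existence of the partial derivative in x at the point, together with existence nearby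
  and continuity at the point of the one in t, gives total differentiability.\<close>

lemma smooth_strip_has_derivative:
  assumes "open J" "smooth_strip f J" "t \<in> J"
  shows "((\<lambda>(x, t). f x t) has_derivative (\<lambda>(dx, dt). dx * pd1 f x t + dt * pd2 f x t)) (at (x, t))"
proof -
  \<comment> \<open>The criterion for partial derivatives asks for a convex range of the second
    variable; a ball inside the open set J provides it.\<close>
  obtain r where r: "r > 0" "ball t r \<subseteq> J"
    using assms(1,3) by (meson openE)
  have "Ck_strip 0 (pd2 f) J"
    using smooth_strip_pd(2)[OF assms(2)] unfolding smooth_strip_def by blast
  then have "continuous_on (UNIV \<times> ball t r) (\<lambda>(x, t). pd2 f x t)"
    using r by (auto elim: continuous_on_subset)
  then have *: "continuous (at (x, t) within UNIV \<times> ball t r) (\<lambda>z. pd2 f (fst z) (snd z))"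
    using r by (simp add: continuous_on_eq_continuous_within split_beta')
  have cont: "continuous (at (x, t) within UNIV \<times> ball t r) 
      (\<lambda>(x, t). blinfun_mult_left (pd2 f x t))"
    using bounded_linear.continuous[OF bounded_linear_blinfun_mult_left *] by (simp add: split_beta')
  have comm: "(\<lambda>h. h * c) = (*) c" for c :: real
    by auto
  have "((\<lambda>(x, t). f x t) has_derivative
      (\<lambda>(tx, ty). (\<lambda>h. h * pd1 f x t) tx + blinfun_apply (blinfun_mult_left (pd2 f x t)) ty))
      (at (x, t) within UNIV \<times> ball t r)"
  proof (rule has_derivative_partialsI[where f = f and fy = "\<lambda>x t. blinfun_mult_left (pd2 f x t)"])
    show "((\<lambda>x. f x t) has_derivative (\<lambda>h. h * pd1 f x t)) (at x)"
      using smooth_strip_DERIV(1)[OF assms(2,3), of x]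
      by (simp add: has_field_derivative_def comm)
    show "((\<lambda>y. f x y) has_derivative blinfun_apply (blinfun_mult_left (pd2 f x y)))
        (at y within ball t r)" if "y \<in> ball t r" for x y
    proof -
      have "y \<in> J" using that r by blast
      from smooth_strip_DERIV(2)[OF assms(2) this, of x] show ?thesis
        by (simp add: has_field_derivative_def comm has_derivative_at_withinI)
    qed
  qed (use r cont in auto)
  moreover have "at (x, t) within UNIV \<times> ball t r = at (x, t)"
    using r by (intro at_within_open) (auto simp: open_Times)
  ultimately show ?thesis by (simp add: split_beta')
qed

subsection \<open>The substitution of the Gardner--Morikawa variables\<close>

text \<open>\<open>h\<close> agrees with the pullback of \<open>f\<close> at the points that correspond to \<open>\<tau> \<in> J\<close>, the only
  ones where \<open>f\<close> is known to be smooth.\<close>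

definition gm_rep :: "real \<Rightarrow> real \<Rightarrow> real \<Rightarrow> real \<Rightarrow> real set \<Rightarrow> field2 \<Rightarrow> field2 \<Rightarrow> bool" where
  "gm_rep \<alpha> \<beta> a0 \<epsilon> J h f \<longleftrightarrow>
     (\<forall>x t. \<epsilon> powr (\<alpha> + \<beta>) * t \<in> J \<longrightarrow> h x t = gm_pull \<alpha> \<beta> a0 \<epsilon> f x t)"

lemma gm_rep_pull: "gm_rep \<alpha> \<beta> a0 \<epsilon> J (gm_pull \<alpha> \<beta> a0 \<epsilon> f) f"
  by (simp add: gm_rep_def)

lemma gm_rep_add:
  "gm_rep \<alpha> \<beta> a0 \<epsilon> J h f \<Longrightarrow> gm_rep \<alpha> \<beta> a0 \<epsilon> J h' f' \<Longrightarrow>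
   gm_rep \<alpha> \<beta> a0 \<epsilon> J (\<lambda>x t. h x t + h' x t) (\<lambda>x t. f x t + f' x t)"
  by (simp add: gm_rep_def gm_pull_def)

lemma gm_rep_mult:
  "gm_rep \<alpha> \<beta> a0 \<epsilon> J h f \<Longrightarrow> gm_rep \<alpha> \<beta> a0 \<epsilon> J h' f' \<Longrightarrow>
   gm_rep \<alpha> \<beta> a0 \<epsilon> J (\<lambda>x t. h x t * h' x t) (\<lambda>x t. f x t * f' x t)"
  by (simp add: gm_rep_def gm_pull_def)

lemma gm_rep_power:
  "gm_rep \<alpha> \<beta> a0 \<epsilon> J h f \<Longrightarrow> gm_rep \<alpha> \<beta> a0 \<epsilon> J (\<lambda>x t. h x t ^ n) (\<lambda>x t. f x t ^ n)"
  by (simp add: gm_rep_def gm_pull_def)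

lemma gm_rep_at:
  assumes "gm_rep \<alpha> \<beta> a0 \<epsilon> J h f" "\<epsilon> > 0" "\<tau> \<in> J"
  shows "gm_at \<alpha> \<beta> a0 \<epsilon> h \<xi> \<tau> = f \<xi> \<tau>"
  using assms by (simp add: gm_rep_def gm_at_def gm_pull_def)

lemma gm_rep_pd1:
  assumes "gm_rep \<alpha> \<beta> a0 \<epsilon> J h f" "smooth_strip f J"
  shows "gm_rep \<alpha> \<beta> a0 \<epsilon> J (pd1 h) (\<lambda>\<xi> \<tau>. \<epsilon> powr \<alpha> * pd1 f \<xi> \<tau>)"
  unfolding gm_rep_def
proof safe
  fix x t assume t: "\<epsilon> powr (\<alpha> + \<beta>) * t \<in> J"
  have "pd1 h x t = pd1 (gm_pull \<alpha> \<beta> a0 \<epsilon> f) x t"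
    by (rule pd1_cong_strip) (use assms t in \<open>auto simp: gm_rep_def\<close>)
  also have "\<dots> = gm_pull \<alpha> \<beta> a0 \<epsilon> (\<lambda>\<xi> \<tau>. \<epsilon> powr \<alpha> * pd1 f \<xi> \<tau>) x t"
  proof (rule pd1_eqI)
    have "((\<lambda>x. \<epsilon> powr \<alpha> * (x - a0 * t)) has_field_derivative \<epsilon> powr \<alpha>) (at x)"
      by (auto intro!: derivative_eq_intros)
    from DERIV_chain2[OF smooth_strip_DERIV(1)[OF assms(2) t] this]
    show "((\<lambda>x. gm_pull \<alpha> \<beta> a0 \<epsilon> f x t) has_field_derivative
        gm_pull \<alpha> \<beta> a0 \<epsilon> (\<lambda>\<xi> \<tau>. \<epsilon> powr \<alpha> * pd1 f \<xi> \<tau>) x t) (at x)"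
      by (simp add: gm_pull_def mult.commute)
  qed
  finally show "pd1 h x t = gm_pull \<alpha> \<beta> a0 \<epsilon> (\<lambda>\<xi> \<tau>. \<epsilon> powr \<alpha> * pd1 f \<xi> \<tau>) x t" .
qed

text \<open>At fixed x, time runs along a slanted line in the (xi, tau) plane with velocity (- a0
  delta, eps^(alpha + beta)); the chain rule along it yields both terms.\<close>

lemma gm_rep_pd2:
  assumes "gm_rep \<alpha> \<beta> a0 \<epsilon> J h f" "smooth_strip f J" "open J"
  shows "gm_rep \<alpha> \<beta> a0 \<epsilon> J (pd2 h)
    (\<lambda>\<xi> \<tau>. \<epsilon> powr (\<alpha> + \<beta>) * pd2 f \<xi> \<tau> - a0 * \<epsilon> powr \<alpha> * pd1 f \<xi> \<tau>)"
  unfolding gm_rep_def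
proof safe
  define \<delta> \<eta> where "\<delta> = \<epsilon> powr \<alpha>" and "\<eta> = \<epsilon> powr (\<alpha> + \<beta>)"
  fix x t assume t: "\<epsilon> powr (\<alpha> + \<beta>) * t \<in> J"
  \<comment> \<open>The times that correspond to tau in J form an open set, so \<open>h\<close> and
    the pullback agree near t and have the same derivative there.\<close>
  have "open ((\<lambda>t. \<eta> * t) -` J)"
    by (intro continuous_open_vimage assms(3)) (auto intro!: continuous_intros)
  then have "pd2 h x t = pd2 (gm_pull \<alpha> \<beta> a0 \<epsilon> f) x t"
    by (rule pd2_cong_strip) (use assms t in \<open>auto simp: gm_rep_def \<eta>_def\<close>)
  also have "\<dots> = \<eta> * pd2 f (\<delta> * (x - a0 * t)) (\<eta> * t) - a0 * \<delta> * pd1 f (\<delta> * (x - a0 * t)) (\<eta> * t)"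
  proof (rule pd2_eqI)
    have 1: "((\<lambda>t. (\<delta> * (x - a0 * t), \<eta> * t)) has_derivative (\<lambda>h. (- (\<delta> * a0 * h), \<eta> * h))) (at t)"
      by (auto intro!: derivative_eq_intros simp: algebra_simps)
    have 2: "((\<lambda>s. f (\<delta> * (x - a0 * s)) (\<eta> * s)) has_derivative
        (\<lambda>h. - (\<delta> * a0 * h) * pd1 f (\<delta> * (x - a0 * t)) (\<eta> * t)
             + \<eta> * h * pd2 f (\<delta> * (x - a0 * t)) (\<eta> * t))) (at t)"
      using has_derivative_compose[OF 1 smooth_strip_has_derivative[OF assms(3,2) t[folded \<eta>_def]]]
      by simp
    show "((\<lambda>s. gm_pull \<alpha> \<beta> a0 \<epsilon> f x s) has_field_derivative
        \<eta> * pd2 f (\<delta> * (x - a0 * t)) (\<eta> * t) - a0 * \<delta> * pd1 f (\<delta> * (x - a0 * t)) (\<eta> * t)) (at t)"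
      unfolding has_field_derivative_def gm_pull_def \<delta>_def[symmetric] \<eta>_def[symmetric]
      by (rule has_derivative_eq_rhs[OF 2]) (auto simp: algebra_simps)
  qed
  finally show "pd2 h x t = gm_pull \<alpha> \<beta> a0 \<epsilon>
    (\<lambda>\<xi> \<tau>. \<epsilon> powr (\<alpha> + \<beta>) * pd2 f \<xi> \<tau> - a0 * \<epsilon> powr \<alpha> * pd1 f \<xi> \<tau>) x t"
    by (simp add: gm_pull_def \<delta>_def \<eta>_def)
qed

subsection \<open>Rational functions of a power of epsilon\<close>

lemma has_fps_expansion_poly: "poly p has_fps_expansion fps_of_poly (p :: real poly)"
  by (simp add: has_fps_expansion_def)

text \<open>Since r(0) is nonzero, p / r has a power series at 0, and multiplying by the series of 1
  / r keeps the first m coefficients of p at zero. The factor delta^m split off from p gives the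
  growth bound. The formula for e is required only where the denominator is nonzero, which holds for
  all small epsilon.\<close>

lemma eps_rational_vanish:
  fixes p r :: "real poly"
  assumes "\<alpha> > 0" "coeff r 0 \<noteq> 0"
    and e: "\<And>\<epsilon>. \<epsilon> > 0 \<Longrightarrow> poly r (\<epsilon> powr \<alpha>) \<noteq> 0 \<Longrightarrow> e \<epsilon> = poly p (\<epsilon> powr \<alpha>) / poly r (\<epsilon> powr \<alpha>)"
    and low: "\<And>i. i < m \<Longrightarrow> coeff p i = 0"
    and S: "S \<subseteq> (\<lambda>n. real n * \<alpha>) ` {..<m}"
  shows "eps_coeffs_vanish \<alpha> e S" "e \<in> O[at_right 0](\<lambda>\<epsilon>. \<epsilon> powr (real m * \<alpha>))"
proof -
  have lim: "((\<lambda>\<epsilon>. \<epsilon> powr \<alpha>) \<longlongrightarrow> 0) (at_right 0)"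
    using assms(1)
    by (intro tendsto_zero_powrI tendsto_const) (auto simp: eventually_at_right_less eventually_at_filter tendsto_ident_at)
  have pos: "\<forall>\<^sub>F \<epsilon> in at_right 0. \<epsilon> > (0 :: real)"
    by (rule eventually_at_right_less)
  have r0: "poly r 0 \<noteq> 0"
    using assms(2) by (simp add: poly_0_coeff_0)
  have "((\<lambda>\<epsilon>. poly r (\<epsilon> powr \<alpha>)) \<longlongrightarrow> poly r 0) (at_right 0)"
    by (intro tendsto_poly lim)
  from tendsto_imp_eventually_ne[OF this r0] pos
  have ev: "\<forall>\<^sub>F \<epsilon> in at_right 0. \<epsilon> > 0 \<and> poly r (\<epsilon> powr \<alpha>) \<noteq> 0"
    by eventually_elim auto

  define F where "F = fps_of_poly p * inverse (fps_of_poly r)"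
  have "(\<lambda>z. poly p z * inverse (poly r z)) has_fps_expansion F"
    unfolding F_def using assms(2)
    by (intro has_fps_expansion_mult has_fps_expansion_inverse has_fps_expansion_poly) simp
  then have F: "fps_conv_radius F > 0" "\<forall>\<^sub>F z in nhds 0. eval_fps F z = poly p z * inverse (poly r z)"
    by (auto simp: has_fps_expansion_def)
  have "\<forall>\<^sub>F \<epsilon> in at_right 0. e \<epsilon> = eval_fps F (\<epsilon> powr \<alpha>)"
    using ev eventually_compose_filterlim[OF F(2) lim]
    by eventually_elim (simp add: e divide_inverse)
  moreover have "fps_nth F n = 0" if "n < m" for n
    unfolding F_def fps_mult_nth using low that by (intro sum.neutral) auto
  \<comment> \<open>As alpha is positive, \<open>real n * \<alpha>\<close> determines n, so
    membership in S forces n < m.\<close>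
  ultimately show "eps_coeffs_vanish \<alpha> e S"
    using S F(1) assms(1) unfolding eps_coeffs_vanish_def eps_series_def by (intro exI[of _ F]) force

  \<comment> \<open>The quotient of e by delta^m is q / r, which has a finite limit at 0; this is
    stronger than boundedness.\<close>
  obtain q where q: "p = monom 1 m * q"
    using low monom_1_dvd_iff'[of m p] by (auto elim: dvdE)
  have "\<forall>\<^sub>F \<epsilon> in at_right 0. poly q (\<epsilon> powr \<alpha>) / poly r (\<epsilon> powr \<alpha>) = e \<epsilon> / \<epsilon> powr (real m * \<alpha>)"
    using ev
  proof eventually_elim
    case (elim \<epsilon>)
    have "\<epsilon> powr (real m * \<alpha>) = (\<epsilon> powr \<alpha>) ^ m"
      using elim by (simp add: powr_power)
    with elim e[of \<epsilon>] show ?case by (simp add: q poly_monom)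
  qed
  moreover have "((\<lambda>\<epsilon>. poly q (\<epsilon> powr \<alpha>) / poly r (\<epsilon> powr \<alpha>)) \<longlongrightarrow> poly q 0 / poly r 0) (at_right 0)"
    by (intro tendsto_divide tendsto_poly lim r0)
  ultimately have "((\<lambda>\<epsilon>. e \<epsilon> / \<epsilon> powr (real m * \<alpha>)) \<longlongrightarrow> poly q 0 / poly r 0) (at_right 0)"
    by (rule Lim_transform_eventually[rotated])
  then show "e \<in> O[at_right 0](\<lambda>\<epsilon>. \<epsilon> powr (real m * \<alpha>))"
    by (rule bigoI_tendsto) (use pos in eventually_elim, simp)
qed

lemma eps_poly_vanish:
  fixes p :: "real poly"
  assumes "\<alpha> > 0" "\<And>\<epsilon>. \<epsilon> > 0 \<Longrightarrow> e \<epsilon> = poly p (\<epsilon> powr \<alpha>)"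
    and "\<And>i. i < m \<Longrightarrow> coeff p i = 0"
    and "S \<subseteq> (\<lambda>n. real n * \<alpha>) ` {..<m}"
  shows "eps_coeffs_vanish \<alpha> e S" "e \<in> O[at_right 0](\<lambda>\<epsilon>. \<epsilon> powr (real m * \<alpha>))"
  using eps_rational_vanish[of \<alpha> "[:1:]" e p m S] assms by simp_all

subsection \<open>The residuals at a point\<close>

lemma smooth_strip_trunc2:
  "open J \<Longrightarrow> smooth_strip f1 J \<Longrightarrow> smooth_strip f2 J \<Longrightarrow> smooth_strip (trunc2 q k \<epsilon> c f1 f2) J"
  unfolding trunc2_def
  by (intro smooth_strip_add smooth_strip_mult smooth_strip_const)

lemma pd_trunc2:
  assumes "smooth_strip f1 J" "smooth_strip f2 J" "\<tau> \<in> J"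
  shows "pd1 (trunc2 q k \<epsilon> c f1 f2) \<xi> \<tau> = trunc2 q k \<epsilon> 0 (pd1 f1) (pd1 f2) \<xi> \<tau>"
    and "pd2 (trunc2 q k \<epsilon> c f1 f2) \<xi> \<tau> = trunc2 q k \<epsilon> 0 (pd2 f1) (pd2 f2) \<xi> \<tau>"
proof -
  note D = smooth_strip_DERIV[OF assms(1,3)] smooth_strip_DERIV[OF assms(2,3)]
  show "pd1 (trunc2 q k \<epsilon> c f1 f2) \<xi> \<tau> = trunc2 q k \<epsilon> 0 (pd1 f1) (pd1 f2) \<xi> \<tau>"
    unfolding trunc2_def by (rule pd1_eqI) (rule derivative_eq_intros D refl | simp)+
  show "pd2 (trunc2 q k \<epsilon> c f1 f2) \<xi> \<tau> = trunc2 q k \<epsilon> 0 (pd2 f1) (pd2 f2) \<xi> \<tau>"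
    unfolding trunc2_def by (rule pd2_eqI) (rule derivative_eq_intros D refl | simp)+
qed

lemma pd_pd_trunc2:
  assumes "open J" "smooth_strip f1 J" "smooth_strip f2 J" "\<tau> \<in> J"
  shows "pd1 (pd1 (trunc2 q k \<epsilon> c f1 f2)) \<xi> \<tau> = trunc2 q k \<epsilon> 0 (pd1 (pd1 f1)) (pd1 (pd1 f2)) \<xi> \<tau>"
    and "pd1 (pd2 (trunc2 q k \<epsilon> c f1 f2)) \<xi> \<tau> = trunc2 q k \<epsilon> 0 (pd1 (pd2 f1)) (pd1 (pd2 f2)) \<xi> \<tau>"
    and "pd2 (pd1 (trunc2 q k \<epsilon> c f1 f2)) \<xi> \<tau> = trunc2 q k \<epsilon> 0 (pd2 (pd1 f1)) (pd2 (pd1 f2)) \<xi> \<tau>"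
    and "pd2 (pd2 (trunc2 q k \<epsilon> c f1 f2)) \<xi> \<tau> = trunc2 q k \<epsilon> 0 (pd2 (pd2 f1)) (pd2 (pd2 f2)) \<xi> \<tau>"
proof -
  note P = pd_trunc2[OF assms(2,3)]
  note S = smooth_strip_pd[OF assms(2)] smooth_strip_pd[OF assms(3)]
  have "pd1 (pd1 (trunc2 q k \<epsilon> c f1 f2)) \<xi> \<tau> = pd1 (trunc2 q k \<epsilon> 0 (pd1 f1) (pd1 f2)) \<xi> \<tau>"
    by (rule pd1_cong_strip) (rule P(1)[OF assms(4)])
  then show "pd1 (pd1 (trunc2 q k \<epsilon> c f1 f2)) \<xi> \<tau> = trunc2 q k \<epsilon> 0 (pd1 (pd1 f1)) (pd1 (pd1 f2)) \<xi> \<tau>"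
    using pd_trunc2(1)[OF S(1,3) assms(4)] by simp
  have "pd1 (pd2 (trunc2 q k \<epsilon> c f1 f2)) \<xi> \<tau> = pd1 (trunc2 q k \<epsilon> 0 (pd2 f1) (pd2 f2)) \<xi> \<tau>"
    by (rule pd1_cong_strip) (rule P(2)[OF assms(4)])
  then show "pd1 (pd2 (trunc2 q k \<epsilon> c f1 f2)) \<xi> \<tau> = trunc2 q k \<epsilon> 0 (pd1 (pd2 f1)) (pd1 (pd2 f2)) \<xi> \<tau>"
    using pd_trunc2(1)[OF S(2,4) assms(4)] by simp
  have "pd2 (pd1 (trunc2 q k \<epsilon> c f1 f2)) \<xi> \<tau> = pd2 (trunc2 q k \<epsilon> 0 (pd1 f1) (pd1 f2)) \<xi> \<tau>"
    by (rule pd2_cong_strip[OF assms(1,4)]) (rule P(1), assumption)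
  then show "pd2 (pd1 (trunc2 q k \<epsilon> c f1 f2)) \<xi> \<tau> = trunc2 q k \<epsilon> 0 (pd2 (pd1 f1)) (pd2 (pd1 f2)) \<xi> \<tau>"
    using pd_trunc2(2)[OF S(1,3) assms(4)] by simp
  have "pd2 (pd2 (trunc2 q k \<epsilon> c f1 f2)) \<xi> \<tau> = pd2 (trunc2 q k \<epsilon> 0 (pd2 f1) (pd2 f2)) \<xi> \<tau>"
    by (rule pd2_cong_strip[OF assms(1,4)]) (rule P(2), assumption)
  then show "pd2 (pd2 (trunc2 q k \<epsilon> c f1 f2)) \<xi> \<tau> = trunc2 q k \<epsilon> 0 (pd2 (pd2 f1)) (pd2 (pd2 f2)) \<xi> \<tau>"
    using pd_trunc2(2)[OF S(2,4) assms(4)] by simp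
qed

text \<open>This is what \<open>material_deriv\<close> becomes in the variables (xi, tau). The sum
  with \<open>- a0\<close> in place of a difference lets the closure rules for sums, products and
  constants prove smoothness.\<close>

definition gm_material :: "real \<Rightarrow> real \<Rightarrow> real \<Rightarrow> real \<Rightarrow> field2 \<Rightarrow> field2 \<Rightarrow> field2" where
  "gm_material \<alpha> \<beta> a0 \<epsilon> u f = (\<lambda>\<xi> \<tau>.
     \<epsilon> powr (\<alpha> + \<beta>) * pd2 f \<xi> \<tau> + \<epsilon> powr \<alpha> * ((u \<xi> \<tau> + - a0) * pd1 f \<xi> \<tau>))"

lemma smooth_strip_gm_material:
  "open J \<Longrightarrow> smooth_strip u J \<Longrightarrow> smooth_strip f J \<Longrightarrow> smooth_strip (gm_material \<alpha> \<beta> a0 \<epsilon> u f) J"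
  unfolding gm_material_def
  by (intro smooth_strip_add smooth_strip_mult smooth_strip_const smooth_strip_pd)

lemma gm_rep_material:
  assumes "open J" "gm_rep \<alpha> \<beta> a0 \<epsilon> J v u" "gm_rep \<alpha> \<beta> a0 \<epsilon> J h f" "smooth_strip f J"
  shows "gm_rep \<alpha> \<beta> a0 \<epsilon> J (material_deriv v h) (gm_material \<alpha> \<beta> a0 \<epsilon> u f)"
  using assms(2) gm_rep_pd1[OF assms(3,4)] gm_rep_pd2[OF assms(3,4,1)]
  by (simp add: gm_rep_def gm_pull_def material_deriv_def gm_material_def algebra_simps)

lemma pd_mult:
  assumes "smooth_strip f J" "smooth_strip g J" "\<tau> \<in> J"
  shows "pd1 (\<lambda>x t. f x t * g x t) \<xi> \<tau> = pd1 f \<xi> \<tau> * g \<xi> \<tau> + pd1 g \<xi> \<tau> * f \<xi> \<tau>"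
    and "pd2 (\<lambda>x t. f x t * g x t) \<xi> \<tau> = pd2 f \<xi> \<tau> * g \<xi> \<tau> + pd2 g \<xi> \<tau> * f \<xi> \<tau>"
  by (rule pd1_eqI pd2_eqI, rule DERIV_mult; rule smooth_strip_DERIV[OF assms(1,3)] smooth_strip_DERIV[OF assms(2,3)])+

text \<open>Needed to apply the material derivative twice, as in E3. The two mixed derivatives stay
  separate terms: later only the power of epsilon in front of them matters.\<close>

lemma pd_gm_material:
  assumes "smooth_strip u J" "smooth_strip f J" "\<tau> \<in> J"
  shows "pd1 (gm_material \<alpha> \<beta> a0 \<epsilon> u f) \<xi> \<tau> = \<epsilon> powr (\<alpha> + \<beta>) * pd1 (pd2 f) \<xi> \<tau>
      + \<epsilon> powr \<alpha> * (pd1 u \<xi> \<tau> * pd1 f \<xi> \<tau> + (u \<xi> \<tau> - a0) * pd1 (pd1 f) \<xi> \<tau>)"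
    and "pd2 (gm_material \<alpha> \<beta> a0 \<epsilon> u f) \<xi> \<tau> = \<epsilon> powr (\<alpha> + \<beta>) * pd2 (pd2 f) \<xi> \<tau>
      + \<epsilon> powr \<alpha> * (pd2 u \<xi> \<tau> * pd1 f \<xi> \<tau> + (u \<xi> \<tau> - a0) * pd2 (pd1 f) \<xi> \<tau>)"
proof -
  note D = smooth_strip_DERIV[OF assms(1,3)] smooth_strip_DERIV[OF smooth_strip_pd(1)[OF assms(2)] assms(3)]
    smooth_strip_DERIV[OF smooth_strip_pd(2)[OF assms(2)] assms(3)]
  show "pd1 (gm_material \<alpha> \<beta> a0 \<epsilon> u f) \<xi> \<tau> = \<epsilon> powr (\<alpha> + \<beta>) * pd1 (pd2 f) \<xi> \<tau>
      + \<epsilon> powr \<alpha> * (pd1 u \<xi> \<tau> * pd1 f \<xi> \<tau> + (u \<xi> \<tau> - a0) * pd1 (pd1 f) \<xi> \<tau>)"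
    unfolding gm_material_def by (rule pd1_eqI) (rule derivative_eq_intros D refl | simp)+
  show "pd2 (gm_material \<alpha> \<beta> a0 \<epsilon> u f) \<xi> \<tau> = \<epsilon> powr (\<alpha> + \<beta>) * pd2 (pd2 f) \<xi> \<tau>
      + \<epsilon> powr \<alpha> * (pd2 u \<xi> \<tau> * pd1 f \<xi> \<tau> + (u \<xi> \<tau> - a0) * pd2 (pd1 f) \<xi> \<tau>)"
    unfolding gm_material_def by (rule pd2_eqI) (rule derivative_eq_intros D refl | simp)+
qed

section \<open>The five residuals expressed through fields of (xi, tau)\<close>

lemma gm_at_E1:
  assumes "open J" "smooth_strip r J" "smooth_strip u J" "\<epsilon> > 0" "\<tau> \<in> J"
  shows "gm_at \<alpha> \<beta> a0 \<epsilon> (E1 (gm_pull \<alpha> \<beta> a0 \<epsilon> r) (gm_pull \<alpha> \<beta> a0 \<epsilon> u)) \<xi> \<tau> =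
    \<epsilon> powr (\<alpha> + \<beta>) * pd2 r \<xi> \<tau> - a0 * \<epsilon> powr \<alpha> * pd1 r \<xi> \<tau>
    + \<epsilon> powr \<alpha> * (pd1 r \<xi> \<tau> * u \<xi> \<tau> + pd1 u \<xi> \<tau> * r \<xi> \<tau>)"
proof -
  have "gm_rep \<alpha> \<beta> a0 \<epsilon> J (E1 (gm_pull \<alpha> \<beta> a0 \<epsilon> r) (gm_pull \<alpha> \<beta> a0 \<epsilon> u))
     (\<lambda>\<xi> \<tau>. \<epsilon> powr (\<alpha> + \<beta>) * pd2 r \<xi> \<tau> - a0 * \<epsilon> powr \<alpha> * pd1 r \<xi> \<tau>
       + \<epsilon> powr \<alpha> * pd1 (\<lambda>x t. r x t * u x t) \<xi> \<tau>)"
    unfolding E1_def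
    by (rule gm_rep_add gm_rep_pd1 gm_rep_pd2 gm_rep_mult gm_rep_pull smooth_strip_mult assms)+
  from gm_rep_at[OF this assms(4,5)] show ?thesis
    by (simp add: pd_mult[OF assms(2,3,5)])
qed

lemma gm_at_E2:
  assumes "open J" "smooth_strip r J" "smooth_strip u J" "smooth_strip P J" "\<epsilon> > 0" "\<tau> \<in> J"
  shows "gm_at \<alpha> \<beta> a0 \<epsilon> (E2 (gm_pull \<alpha> \<beta> a0 \<epsilon> r) (gm_pull \<alpha> \<beta> a0 \<epsilon> u) (gm_pull \<alpha> \<beta> a0 \<epsilon> P)) \<xi> \<tau> =
    \<epsilon> powr (\<alpha> + \<beta>) * (pd2 r \<xi> \<tau> * u \<xi> \<tau> + pd2 u \<xi> \<tau> * r \<xi> \<tau>)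
    - a0 * \<epsilon> powr \<alpha> * (pd1 r \<xi> \<tau> * u \<xi> \<tau> + pd1 u \<xi> \<tau> * r \<xi> \<tau>)
    + \<epsilon> powr \<alpha> * (pd1 r \<xi> \<tau> * (u \<xi> \<tau>)\<^sup>2 + 2 * r \<xi> \<tau> * u \<xi> \<tau> * pd1 u \<xi> \<tau> + pd1 P \<xi> \<tau>)
    - (\<epsilon> powr \<alpha>)\<^sup>2 * pd1 (pd1 u) \<xi> \<tau>"
proof -
  note D = smooth_strip_DERIV(1)[OF assms(2,6)] smooth_strip_DERIV(1)[OF assms(3,6)]
    smooth_strip_DERIV(1)[OF assms(4,6)] smooth_strip_DERIV(1)[OF smooth_strip_pd(1)[OF assms(3)] assms(6)]
  have r1: "gm_rep \<alpha> \<beta> a0 \<epsilon> J (\<lambda>x t. pd2 (\<lambda>x t. gm_pull \<alpha> \<beta> a0 \<epsilon> r x t * gm_pull \<alpha> \<beta> a0 \<epsilon> u x t) x t)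
     (\<lambda>\<xi> \<tau>. \<epsilon> powr (\<alpha> + \<beta>) * pd2 (\<lambda>x t. r x t * u x t) \<xi> \<tau> - a0 * \<epsilon> powr \<alpha> * pd1 (\<lambda>x t. r x t * u x t) \<xi> \<tau>)"
    by (rule gm_rep_pd2 gm_rep_mult gm_rep_pull smooth_strip_mult assms)+
  have r2: "gm_rep \<alpha> \<beta> a0 \<epsilon> J (\<lambda>x t. pd1 (\<lambda>x t. gm_pull \<alpha> \<beta> a0 \<epsilon> r x t * (gm_pull \<alpha> \<beta> a0 \<epsilon> u x t)\<^sup>2
        + gm_pull \<alpha> \<beta> a0 \<epsilon> P x t) x t)
     (\<lambda>\<xi> \<tau>. \<epsilon> powr \<alpha> * pd1 (\<lambda>x t. r x t * (u x t)\<^sup>2 + P x t) \<xi> \<tau>)"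
    by (rule gm_rep_pd1 gm_rep_add gm_rep_mult gm_rep_power gm_rep_pull
          smooth_strip_add smooth_strip_mult smooth_strip_power assms)+
  have r3: "gm_rep \<alpha> \<beta> a0 \<epsilon> J (\<lambda>x t. pd1 (pd1 (gm_pull \<alpha> \<beta> a0 \<epsilon> u)) x t)
     (\<lambda>\<xi> \<tau>. \<epsilon> powr \<alpha> * pd1 (\<lambda>\<xi> \<tau>. \<epsilon> powr \<alpha> * pd1 u \<xi> \<tau>) \<xi> \<tau>)"
    by (rule gm_rep_pd1 gm_rep_pull smooth_strip_mult smooth_strip_const smooth_strip_pd assms)+
  have d1: "pd1 (\<lambda>x t. r x t * (u x t)\<^sup>2 + P x t) \<xi> \<tau> =
      pd1 r \<xi> \<tau> * (u \<xi> \<tau>)\<^sup>2 + 2 * r \<xi> \<tau> * u \<xi> \<tau> * pd1 u \<xi> \<tau> + pd1 P \<xi> \<tau>"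
    by (rule pd1_eqI) (rule derivative_eq_intros D refl | simp)+
  have d2: "pd1 (\<lambda>\<xi> \<tau>. \<epsilon> powr \<alpha> * pd1 u \<xi> \<tau>) \<xi> \<tau> = \<epsilon> powr \<alpha> * pd1 (pd1 u) \<xi> \<tau>"
    by (rule pd1_eqI) (rule derivative_eq_intros D refl | simp)+
  have "gm_rep \<alpha> \<beta> a0 \<epsilon> J (E2 (gm_pull \<alpha> \<beta> a0 \<epsilon> r) (gm_pull \<alpha> \<beta> a0 \<epsilon> u) (gm_pull \<alpha> \<beta> a0 \<epsilon> P))
     (\<lambda>\<xi> \<tau>. \<epsilon> powr (\<alpha> + \<beta>) * pd2 (\<lambda>x t. r x t * u x t) \<xi> \<tau> - a0 * \<epsilon> powr \<alpha> * pd1 (\<lambda>x t. r x t * u x t) \<xi> \<tau>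
       + \<epsilon> powr \<alpha> * pd1 (\<lambda>x t. r x t * (u x t)\<^sup>2 + P x t) \<xi> \<tau>
       - \<epsilon> powr \<alpha> * pd1 (\<lambda>\<xi> \<tau>. \<epsilon> powr \<alpha> * pd1 u \<xi> \<tau>) \<xi> \<tau>)"
    using r1 r2 r3 unfolding E2_def gm_rep_def gm_pull_def by simp
  from gm_rep_at[OF this assms(5,6), of \<xi>] show ?thesis
    unfolding d1 d2 pd_mult[OF assms(2,3,6)] by (simp add: power2_eq_square algebra_simps)
qed

lemma gm_at_E3:
  assumes "open J" "smooth_strip u J" "smooth_strip R J" "\<epsilon> > 0" "\<tau> \<in> J"
    and "M = gm_material \<alpha> \<beta> a0 \<epsilon> u R"
  shows "gm_at \<alpha> \<beta> a0 \<epsilon> (E3 \<sigma> (gm_pull \<alpha> \<beta> a0 \<epsilon> u) (gm_pull \<alpha> \<beta> a0 \<epsilon> P)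
      (gm_pull \<alpha> \<beta> a0 \<epsilon> Pg) (gm_pull \<alpha> \<beta> a0 \<epsilon> R)) \<xi> \<tau> =
    P \<xi> \<tau> - Pg \<xi> \<tau> + R \<xi> \<tau> * gm_material \<alpha> \<beta> a0 \<epsilon> u M \<xi> \<tau> + 3/2 * (M \<xi> \<tau>)\<^sup>2
    + 4/3 * (M \<xi> \<tau> / R \<xi> \<tau>) + 2 * \<sigma> / R \<xi> \<tau>"
proof -
  have r1: "gm_rep \<alpha> \<beta> a0 \<epsilon> J (material_deriv (gm_pull \<alpha> \<beta> a0 \<epsilon> u) (gm_pull \<alpha> \<beta> a0 \<epsilon> R)) M"
    unfolding assms(6) by (rule gm_rep_material gm_rep_pull assms)+
  have "smooth_strip M J"
    unfolding assms(6) by (rule smooth_strip_gm_material assms)+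
  with r1 have r2: "gm_rep \<alpha> \<beta> a0 \<epsilon> J (material_deriv (gm_pull \<alpha> \<beta> a0 \<epsilon> u)
      (material_deriv (gm_pull \<alpha> \<beta> a0 \<epsilon> u) (gm_pull \<alpha> \<beta> a0 \<epsilon> R))) (gm_material \<alpha> \<beta> a0 \<epsilon> u M)"
    by (intro gm_rep_material gm_rep_pull assms)
  have "gm_rep \<alpha> \<beta> a0 \<epsilon> J (E3 \<sigma> (gm_pull \<alpha> \<beta> a0 \<epsilon> u) (gm_pull \<alpha> \<beta> a0 \<epsilon> P)
      (gm_pull \<alpha> \<beta> a0 \<epsilon> Pg) (gm_pull \<alpha> \<beta> a0 \<epsilon> R)) (\<lambda>\<xi> \<tau>.
    P \<xi> \<tau> - Pg \<xi> \<tau> + R \<xi> \<tau> * gm_material \<alpha> \<beta> a0 \<epsilon> u M \<xi> \<tau> + 3/2 * (M \<xi> \<tau>)\<^sup>2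
    + 4/3 * (M \<xi> \<tau> / R \<xi> \<tau>) + 2 * \<sigma> / R \<xi> \<tau>)"
    using r1 r2 unfolding E3_def gm_rep_def by (simp add: gm_pull_def)
  from gm_rep_at[OF this assms(4,5)] show ?thesis .
qed

lemma gm_at_E4:
  assumes "open J" "smooth_strip u J" "smooth_strip Pg J" "smooth_strip R J" "\<epsilon> > 0" "\<tau> \<in> J"
  shows "gm_at \<alpha> \<beta> a0 \<epsilon> (E4 \<gamma> T0 P20 R0 (gm_pull \<alpha> \<beta> a0 \<epsilon> u)
      (gm_pull \<alpha> \<beta> a0 \<epsilon> Pg) (gm_pull \<alpha> \<beta> a0 \<epsilon> R)) \<xi> \<tau> =
    gm_material \<alpha> \<beta> a0 \<epsilon> u Pg \<xi> \<tau> + 3 * \<gamma> * Pg \<xi> \<tau> * (gm_material \<alpha> \<beta> a0 \<epsilon> u R \<xi> \<tau> / R \<xi> \<tau>)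
    + 3 * (\<gamma> - 1) * (T0 / R \<xi> \<tau>) * (Pg \<xi> \<tau> * (R \<xi> \<tau>)^3 / (P20 * R0^3) - 1)"
proof -
  have r1: "gm_rep \<alpha> \<beta> a0 \<epsilon> J (material_deriv (gm_pull \<alpha> \<beta> a0 \<epsilon> u) (gm_pull \<alpha> \<beta> a0 \<epsilon> R))
      (gm_material \<alpha> \<beta> a0 \<epsilon> u R)"
    "gm_rep \<alpha> \<beta> a0 \<epsilon> J (material_deriv (gm_pull \<alpha> \<beta> a0 \<epsilon> u) (gm_pull \<alpha> \<beta> a0 \<epsilon> Pg))
      (gm_material \<alpha> \<beta> a0 \<epsilon> u Pg)"
    by (rule gm_rep_material gm_rep_pull assms)+
  have "gm_rep \<alpha> \<beta> a0 \<epsilon> J (E4 \<gamma> T0 P20 R0 (gm_pull \<alpha> \<beta> a0 \<epsilon> u)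
      (gm_pull \<alpha> \<beta> a0 \<epsilon> Pg) (gm_pull \<alpha> \<beta> a0 \<epsilon> R)) (\<lambda>\<xi> \<tau>.
    gm_material \<alpha> \<beta> a0 \<epsilon> u Pg \<xi> \<tau> + 3 * \<gamma> * Pg \<xi> \<tau> * (gm_material \<alpha> \<beta> a0 \<epsilon> u R \<xi> \<tau> / R \<xi> \<tau>)
    + 3 * (\<gamma> - 1) * (T0 / R \<xi> \<tau>) * (Pg \<xi> \<tau> * (R \<xi> \<tau>)^3 / (P20 * R0^3) - 1))"
    using r1 unfolding E4_def gm_rep_def by (simp add: gm_pull_def)
  from gm_rep_at[OF this assms(5,6)] show ?thesis .
qed

lemma gm_at_E5:
  assumes "\<epsilon> > 0" "\<tau> \<in> J"
  shows "gm_at \<alpha> \<beta> a0 \<epsilon> (E5 X (gm_pull \<alpha> \<beta> a0 \<epsilon> r) (gm_pull \<alpha> \<beta> a0 \<epsilon> R)) \<xi> \<tau> =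
    (1 - X + (R \<xi> \<tau>)^3) * r \<xi> \<tau> - 1"
  using assms by (simp add: gm_at_def gm_pull_def E5_def)

subsection \<open>Order conditions for the truncated expansions\<close>

lemma trunc2_poly:
  "trunc2 \<alpha> \<alpha> \<epsilon> c f1 f2 \<xi> \<tau> = poly [:c, f1 \<xi> \<tau>, f2 \<xi> \<tau>:] (\<epsilon> powr \<alpha>)"
  unfolding trunc2_def powr_add by (simp add: algebra_simps)

text \<open>The material derivative of a truncated expansion divided by \<open>\<delta>\<^sup>2\<close>, where
  \<open>\<delta> = \<epsilon>\<^sup>\<alpha>\<close>.\<close>

definition material_poly :: "real \<Rightarrow> field2 \<Rightarrow> field2 \<Rightarrow> field2 \<Rightarrow> field2 \<Rightarrow> real \<Rightarrow> real \<Rightarrow> real poly" where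
  "material_poly a0 u1 u2 f1 f2 \<xi> \<tau> = [:- a0, u1 \<xi> \<tau>, u2 \<xi> \<tau>:] * [:pd1 f1 \<xi> \<tau>, pd1 f2 \<xi> \<tau>:]
     + [:0, pd2 f1 \<xi> \<tau>, pd2 f2 \<xi> \<tau>:]"

lemma coeff_material_poly_0: "coeff (material_poly a0 u1 u2 f1 f2 \<xi> \<tau>) 0 = - a0 * pd1 f1 \<xi> \<tau>"
  by (simp add: material_poly_def)

text \<open>Differentiation removes the constant \<open>c\<close>, so one factor delta comes from
  the remaining field and one from the operator.\<close>

lemma gm_material_trunc2:
  assumes "smooth_strip f1 J" "smooth_strip f2 J" "\<tau> \<in> J" "\<epsilon> > 0"
  shows "gm_material \<alpha> \<alpha> a0 \<epsilon> (trunc2 \<alpha> \<alpha> \<epsilon> 0 u1 u2) (trunc2 \<alpha> \<alpha> \<epsilon> c f1 f2) \<xi> \<tau> =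
    poly (pCons 0 (pCons 0 (material_poly a0 u1 u2 f1 f2 \<xi> \<tau>))) (\<epsilon> powr \<alpha>)"
  unfolding gm_material_def pd_trunc2[OF assms(1-3)] trunc2_poly material_poly_def powr_add
  by (simp add: algebra_simps)

text \<open>Two operators and the nonconstant part of the field contribute one factor delta each.
  Only divisibility by delta^3 matters, hence \<open>K\<close> is left abstract: the inertia term
  cannot reach the orders delta and delta^2 of E3.\<close>

lemma gm_material_material_trunc2:
  assumes "open J" "smooth_strip u1 J" "smooth_strip u2 J" "smooth_strip f1 J" "smooth_strip f2 J" "\<tau> \<in> J"
  obtains K where "\<And>\<epsilon>. \<epsilon> > 0 \<Longrightarrow>
    gm_material \<alpha> \<alpha> a0 \<epsilon> (trunc2 \<alpha> \<alpha> \<epsilon> 0 u1 u2)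
      (gm_material \<alpha> \<alpha> a0 \<epsilon> (trunc2 \<alpha> \<alpha> \<epsilon> 0 u1 u2) (trunc2 \<alpha> \<alpha> \<epsilon> c f1 f2)) \<xi> \<tau> =
    poly (pCons 0 (pCons 0 (pCons 0 K))) (\<epsilon> powr \<alpha>)"
proof -
  define V where "V = [:- a0, u1 \<xi> \<tau>, u2 \<xi> \<tau>:]"
  let ?p = "\<lambda>f1 f2. [:f1 \<xi> \<tau>, f2 \<xi> \<tau>:] :: real poly"
  \<comment> \<open>The expanded double material derivative divided by delta^3, with
    \<open>V\<close> the polynomial of u - a0.\<close>
  define K where "K = pCons 0 (pCons 0 (?p (pd2 (pd2 f1)) (pd2 (pd2 f2)) + ?p (pd2 u1) (pd2 u2) * ?p (pd1 f1) (pd1 f2)))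
    + pCons 0 (V * ?p (pd2 (pd1 f1)) (pd2 (pd1 f2)))
    + V * (pCons 0 (?p (pd1 (pd2 f1)) (pd1 (pd2 f2)) + ?p (pd1 u1) (pd1 u2) * ?p (pd1 f1) (pd1 f2))
      + V * ?p (pd1 (pd1 f1)) (pd1 (pd1 f2)))"
  show thesis
  proof (rule that[of K])
    fix \<epsilon> :: real assume eps: "\<epsilon> > 0"
    let ?U = "trunc2 \<alpha> \<alpha> \<epsilon> 0 u1 u2" and ?F = "trunc2 \<alpha> \<alpha> \<epsilon> c f1 f2"
    define d where "d = \<epsilon> powr \<alpha>"
    have S: "smooth_strip ?U J" "smooth_strip ?F J"
      by (rule smooth_strip_trunc2 assms)+
    have tp: "trunc2 \<alpha> \<alpha> \<epsilon> 0 g1 g2 \<xi> \<tau> = d * poly (?p g1 g2) d" for g1 g2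
      by (simp add: trunc2_poly d_def)
    have V: "?U \<xi> \<tau> - a0 = poly V d"
      by (simp add: trunc2_poly V_def d_def)
    have "gm_material \<alpha> \<alpha> a0 \<epsilon> ?U (gm_material \<alpha> \<alpha> a0 \<epsilon> ?U ?F) \<xi> \<tau> =
      d * d * (d * d * pd2 (pd2 ?F) \<xi> \<tau> + d * (pd2 ?U \<xi> \<tau> * pd1 ?F \<xi> \<tau> + poly V d * pd2 (pd1 ?F) \<xi> \<tau>))
      + d * (poly V d * (d * d * pd1 (pd2 ?F) \<xi> \<tau> + d * (pd1 ?U \<xi> \<tau> * pd1 ?F \<xi> \<tau> + poly V d * pd1 (pd1 ?F) \<xi> \<tau>)))"
      by (simp only: gm_material_def[of \<alpha> \<alpha> a0 \<epsilon> ?U "gm_material \<alpha> \<alpha> a0 \<epsilon> ?U ?F"]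
          pd_gm_material[OF S assms(6)] powr_add d_def[symmetric] V diff_conv_add_uminus[symmetric])
    also have "\<dots> = poly (pCons 0 (pCons 0 (pCons 0 K))) d"
      unfolding pd_trunc2[OF assms(2,3,6)] pd_trunc2[OF assms(4,5,6)] pd_pd_trunc2[OF assms(1,4,5,6)] tp K_def
        poly_pCons poly_add poly_mult poly_0
      by algebra
    finally show "gm_material \<alpha> \<alpha> a0 \<epsilon> ?U (gm_material \<alpha> \<alpha> a0 \<epsilon> ?U ?F) \<xi> \<tau> =
      poly (pCons 0 (pCons 0 (pCons 0 K))) (\<epsilon> powr \<alpha>)" by (simp add: d_def)
  qed
qed

lemma coeff_pCons_pCons_low:
  assumes "coeff q 0 = 0" "coeff q 1 = 0" "i < 4"
  shows "coeff (pCons 0 (pCons 0 q)) i = 0"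
  using assms by (auto simp: coeff_pCons split: nat.splits simp: less_Suc_eq numeral_eq_Suc)

lemma low_coeffs_3:
  assumes "coeff q 0 = 0" "coeff q 1 = 0" "coeff q 2 = 0" "i < 3"
  shows "coeff q i = 0"
  using assms by (auto simp: less_Suc_eq numeral_eq_Suc)

text \<open>The bounds 4 and 3 exceed the last cancelled multiple of alpha by one, so the same m
  serves for the vanishing coefficients and for the order of the remainder.\<close>

lemma exponents_mem:
  "{\<alpha> + \<alpha>, \<alpha> + \<alpha> + \<alpha>} \<subseteq> (\<lambda>n. real n * \<alpha>) ` {..<4}"
  "{\<alpha>, \<alpha> + \<alpha>} \<subseteq> (\<lambda>n. real n * \<alpha>) ` {..<3}"
  by (auto intro: image_eqI[of _ _ "1::nat"] image_eqI[of _ _ "2::nat"] image_eqI[of _ _ "3::nat"])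

section \<open>Coefficient equations that make each residual vanish to the required order\<close>

text \<open>The two equations assumed are the coefficients of delta^2 and delta^3; the derivative in
  tau carries an extra delta and so enters only the second.\<close>

lemma E1_trunc2_vanish:
  fixes r1 r2 u1 u2 :: field2
  assumes "\<alpha> > 0" "open J" "smooth_strip r1 J" "smooth_strip r2 J" "smooth_strip u1 J" "smooth_strip u2 J" "\<tau> \<in> J"
    and "- a0 * pd1 r1 \<xi> \<tau> + r0 * pd1 u1 \<xi> \<tau> = 0"
    and "pd2 r1 \<xi> \<tau> - a0 * pd1 r2 \<xi> \<tau> + u1 \<xi> \<tau> * pd1 r1 \<xi> \<tau> + r0 * pd1 u2 \<xi> \<tau> + r1 \<xi> \<tau> * pd1 u1 \<xi> \<tau> = 0"
    and "e = (\<lambda>\<epsilon>. gm_at \<alpha> \<alpha> a0 \<epsilon> (E1 (gm_pull \<alpha> \<alpha> a0 \<epsilon> (trunc2 \<alpha> \<alpha> \<epsilon> r0 r1 r2))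
           (gm_pull \<alpha> \<alpha> a0 \<epsilon> (trunc2 \<alpha> \<alpha> \<epsilon> 0 u1 u2))) \<xi> \<tau>)"
  shows "eps_coeffs_vanish \<alpha> e {\<alpha> + \<alpha>, \<alpha> + \<alpha> + \<alpha>} \<and> e \<in> O[at_right 0](\<lambda>\<epsilon>. \<epsilon> powr (4 * \<alpha>))"
proof -
  define q where "q = [:0, pd2 r1 \<xi> \<tau>, pd2 r2 \<xi> \<tau>:]
    + [:- a0, u1 \<xi> \<tau>, u2 \<xi> \<tau>:] * [:pd1 r1 \<xi> \<tau>, pd1 r2 \<xi> \<tau>:]
    + [:r0, r1 \<xi> \<tau>, r2 \<xi> \<tau>:] * [:pd1 u1 \<xi> \<tau>, pd1 u2 \<xi> \<tau>:]"
  have "e \<epsilon> = poly (pCons 0 (pCons 0 q)) (\<epsilon> powr \<alpha>)" if "\<epsilon> > 0" for \<epsilon>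
    unfolding assms(10) gm_at_E1[OF assms(2) smooth_strip_trunc2[OF assms(2-4)] smooth_strip_trunc2[OF assms(2,5,6)] that assms(7)]
      pd_trunc2[OF assms(3,4,7)] pd_trunc2[OF assms(5-7)] trunc2_poly powr_add q_def
    by (simp add: algebra_simps)
  moreover have "coeff (pCons 0 (pCons 0 q)) i = 0" if "i < 4" for i
    using that assms(8,9) by (intro coeff_pCons_pCons_low) (auto simp: q_def algebra_simps)
  ultimately show ?thesis
    using eps_poly_vanish[OF assms(1) _ _ exponents_mem(1), of e "pCons 0 (pCons 0 q)"] by auto
qed

text \<open>At delta^3 the viscous term contributes the second derivative of u1, and the flux of
  momentum contributes only through rho_0 u1^2, since every other part of it has higher
  order.\<close>

lemma E2_trunc2_vanish:
  fixes r1 r2 u1 u2 P1 P2 :: field2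
  assumes "\<alpha> > 0" "open J" "smooth_strip r1 J" "smooth_strip r2 J" "smooth_strip u1 J" "smooth_strip u2 J"
    and "smooth_strip P1 J" "smooth_strip P2 J" "\<tau> \<in> J"
    and "pd1 P1 \<xi> \<tau> - a0 * r0 * pd1 u1 \<xi> \<tau> = 0"
    and "r0 * pd2 u1 \<xi> \<tau> - a0 * (pd1 r1 \<xi> \<tau> * u1 \<xi> \<tau> + r0 * pd1 u2 \<xi> \<tau> + r1 \<xi> \<tau> * pd1 u1 \<xi> \<tau>)
      + 2 * r0 * u1 \<xi> \<tau> * pd1 u1 \<xi> \<tau> + pd1 P2 \<xi> \<tau> - pd1 (pd1 u1) \<xi> \<tau> = 0"
    and "e = (\<lambda>\<epsilon>. gm_at \<alpha> \<alpha> a0 \<epsilon> (E2 (gm_pull \<alpha> \<alpha> a0 \<epsilon> (trunc2 \<alpha> \<alpha> \<epsilon> r0 r1 r2))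
           (gm_pull \<alpha> \<alpha> a0 \<epsilon> (trunc2 \<alpha> \<alpha> \<epsilon> 0 u1 u2)) (gm_pull \<alpha> \<alpha> a0 \<epsilon> (trunc2 \<alpha> \<alpha> \<epsilon> P0 P1 P2))) \<xi> \<tau>)"
  shows "eps_coeffs_vanish \<alpha> e {\<alpha> + \<alpha>, \<alpha> + \<alpha> + \<alpha>} \<and> e \<in> O[at_right 0](\<lambda>\<epsilon>. \<epsilon> powr (4 * \<alpha>))"
proof -
  let ?r = "[:r0, r1 \<xi> \<tau>, r2 \<xi> \<tau>:]" and ?u = "[:0, u1 \<xi> \<tau>, u2 \<xi> \<tau>:]"
    and ?rx = "[:pd1 r1 \<xi> \<tau>, pd1 r2 \<xi> \<tau>:]" and ?ux = "[:pd1 u1 \<xi> \<tau>, pd1 u2 \<xi> \<tau>:]"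
    and ?rt = "[:pd2 r1 \<xi> \<tau>, pd2 r2 \<xi> \<tau>:]" and ?ut = "[:pd2 u1 \<xi> \<tau>, pd2 u2 \<xi> \<tau>:]"
  define q where "q = pCons 0 (?rt * ?u + ?r * ?ut) - smult a0 (?rx * ?u + ?r * ?ux)
     + ?rx * ?u\<^sup>2 + smult 2 (?r * ?u * ?ux) + [:pd1 P1 \<xi> \<tau>, pd1 P2 \<xi> \<tau>:]
     - [:0, pd1 (pd1 u1) \<xi> \<tau>, pd1 (pd1 u2) \<xi> \<tau>:]"
  have "e \<epsilon> = poly (pCons 0 (pCons 0 q)) (\<epsilon> powr \<alpha>)" if "\<epsilon> > 0" for \<epsilon>
    unfolding assms(12) gm_at_E2[OF assms(2) smooth_strip_trunc2[OF assms(2-4)] smooth_strip_trunc2[OF assms(2,5,6)]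
        smooth_strip_trunc2[OF assms(2,7,8)] that assms(9)]
      pd_trunc2[OF assms(3,4,9)] pd_trunc2[OF assms(5,6,9)] pd_trunc2[OF assms(7,8,9)]
      pd_pd_trunc2[OF assms(2,5,6,9)] trunc2_poly powr_add q_def
      poly_pCons poly_add poly_mult poly_0 poly_power poly_smult poly_diff
    by algebra
  moreover have "coeff (pCons 0 (pCons 0 q)) i = 0" if "i < 4" for i
    using that assms(10,11) by (intro coeff_pCons_pCons_low) (auto simp: q_def power2_eq_square algebra_simps)
  ultimately show ?thesis
    using eps_poly_vanish[OF assms(1) _ _ exponents_mem(1), of e "pCons 0 (pCons 0 q)"] by auto
qed

text \<open>Multiplication by R clears the denominators, and the assumed equations are the
  coefficients of 1, delta and delta^2 of the product. The constant one is the equilibrium pressure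
  jump; of the terms with a material derivative, only the damping term reaches delta^2.\<close>

lemma E3_trunc2_vanish:
  fixes u1 u2 R1 R2 P1 P2 P21 P22 :: field2
  assumes "\<alpha> > 0" "open J" "smooth_strip u1 J" "smooth_strip u2 J" "smooth_strip R1 J" "smooth_strip R2 J" "\<tau> \<in> J"
    and "R0 \<noteq> 0" "R0 * (P0 - P20) + 2 * \<sigma> = 0"
    and "R0 * (P1 \<xi> \<tau> - P21 \<xi> \<tau>) + R1 \<xi> \<tau> * (P0 - P20) = 0"
    and "R0 * (P2 \<xi> \<tau> - P22 \<xi> \<tau>) + R1 \<xi> \<tau> * (P1 \<xi> \<tau> - P21 \<xi> \<tau>) + R2 \<xi> \<tau> * (P0 - P20)
      - 4/3 * a0 * pd1 R1 \<xi> \<tau> = 0"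
    and "e = (\<lambda>\<epsilon>. gm_at \<alpha> \<alpha> a0 \<epsilon> (E3 \<sigma> (gm_pull \<alpha> \<alpha> a0 \<epsilon> (trunc2 \<alpha> \<alpha> \<epsilon> 0 u1 u2))
           (gm_pull \<alpha> \<alpha> a0 \<epsilon> (trunc2 \<alpha> \<alpha> \<epsilon> P0 P1 P2)) (gm_pull \<alpha> \<alpha> a0 \<epsilon> (trunc2 \<alpha> \<alpha> \<epsilon> P20 P21 P22))
           (gm_pull \<alpha> \<alpha> a0 \<epsilon> (trunc2 \<alpha> \<alpha> \<epsilon> R0 R1 R2))) \<xi> \<tau>)"
  shows "eps_coeffs_vanish \<alpha> e {\<alpha>, \<alpha> + \<alpha>} \<and> e \<in> O[at_right 0](\<lambda>\<epsilon>. \<epsilon> powr (3 * \<alpha>))"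
proof -
  obtain K where K: "\<And>\<epsilon>. \<epsilon> > 0 \<Longrightarrow>
    gm_material \<alpha> \<alpha> a0 \<epsilon> (trunc2 \<alpha> \<alpha> \<epsilon> 0 u1 u2)
      (gm_material \<alpha> \<alpha> a0 \<epsilon> (trunc2 \<alpha> \<alpha> \<epsilon> 0 u1 u2) (trunc2 \<alpha> \<alpha> \<epsilon> R0 R1 R2)) \<xi> \<tau> =
    poly (pCons 0 (pCons 0 (pCons 0 K))) (\<epsilon> powr \<alpha>)"
    using gm_material_material_trunc2[OF assms(2-7)] by blast
  define M where "M = material_poly a0 u1 u2 R1 R2 \<xi> \<tau>"
  let ?R = "[:R0, R1 \<xi> \<tau>, R2 \<xi> \<tau>:]" and ?M = "pCons 0 (pCons 0 M)"
  define p where "p = ?R * [:P0 - P20, P1 \<xi> \<tau> - P21 \<xi> \<tau>, P2 \<xi> \<tau> - P22 \<xi> \<tau>:]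
    + pCons 0 (pCons 0 (pCons 0 (?R\<^sup>2 * K))) + pCons 0 (pCons 0 (pCons 0 (pCons 0 (smult (3/2) (?R * M\<^sup>2)))))
    + smult (4/3) ?M + [:2 * \<sigma>:]"
  have "e \<epsilon> = poly p (\<epsilon> powr \<alpha>) / poly ?R (\<epsilon> powr \<alpha>)" if "\<epsilon> > 0" "poly ?R (\<epsilon> powr \<alpha>) \<noteq> 0" for \<epsilon>
  proof -
    define d where "d = \<epsilon> powr \<alpha>"
    define R where "R = poly ?R d"
    have Rnz: "R \<noteq> 0"
      unfolding R_def d_def by (rule that(2))
    have "e \<epsilon> = poly [:P0, P1 \<xi> \<tau>, P2 \<xi> \<tau>:] d - poly [:P20, P21 \<xi> \<tau>, P22 \<xi> \<tau>:] d
      + R * poly (pCons 0 (pCons 0 (pCons 0 K))) d + 3/2 * (poly ?M d)\<^sup>2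
      + 4/3 * (poly ?M d / R) + 2 * \<sigma> / R"
      unfolding assms(12) gm_at_E3[OF assms(2) smooth_strip_trunc2[OF assms(2-4)]
          smooth_strip_trunc2[OF assms(2,5,6)] that(1) assms(7) refl]
        K[OF that(1)] gm_material_trunc2[OF assms(5-7) that(1)] trunc2_poly M_def R_def d_def ..
    also have "\<dots> = (R * (poly [:P0, P1 \<xi> \<tau>, P2 \<xi> \<tau>:] d - poly [:P20, P21 \<xi> \<tau>, P22 \<xi> \<tau>:] d)
      + R\<^sup>2 * poly (pCons 0 (pCons 0 (pCons 0 K))) d + 3/2 * (R * (poly ?M d)\<^sup>2)
      + 4/3 * poly ?M d + 2 * \<sigma>) / R"
      using Rnz by (simp add: field_simps power2_eq_square del: poly_pCons)
    also have "\<dots> = poly p d / R"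
      unfolding p_def R_def poly_pCons poly_add poly_mult poly_0 poly_power poly_smult poly_diff
      \<comment> \<open>With the common denominator set aside, equality of the numerators is a ring
        identity.\<close>
      by (rule arg_cong2[where f = "(/)"], algebra, rule refl)
    finally show ?thesis by (simp add: R_def d_def)
  qed
  moreover have "coeff p i = 0" if "i < 3" for i
  proof (rule low_coeffs_3[OF _ _ _ that])
    have M: "coeff ?M 2 = - a0 * pd1 R1 \<xi> \<tau>" "coeff ?M 1 = 0"
      using coeff_material_poly_0[of a0 u1 u2 R1 R2 \<xi> \<tau>] by (simp_all add: M_def numeral_2_eq_2)
    show "coeff p 0 = 0" "coeff p 1 = 0" "coeff p 2 = 0"
      using assms(9-11) M unfolding p_def
      by (simp_all add: coeff_pCons numeral_2_eq_2 algebra_simps)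
  qed
  moreover have "coeff ?R 0 \<noteq> 0" using assms(8) by simp
  ultimately show ?thesis
    using eps_rational_vanish[OF assms(1) _ _ _ exponents_mem(2), of ?R e p] by auto
qed

text \<open>After multiplication by R, the heat term is a polynomial whose constant coefficient
  vanishes by the normalization with P20 R0^3. It alone is present at order delta, where it gives
  the linearized isothermal law; the transport terms start at delta^2.\<close>

lemma E4_trunc2_vanish:
  fixes u1 u2 R1 R2 P21 P22 :: field2
  assumes "\<alpha> > 0" "open J" "smooth_strip u1 J" "smooth_strip u2 J" "smooth_strip P21 J" "smooth_strip P22 J"
    and "smooth_strip R1 J" "smooth_strip R2 J" "\<tau> \<in> J" "R0 \<noteq> 0" "P20 \<noteq> 0"
    and "P21 \<xi> \<tau> * R0 + 3 * P20 * R1 \<xi> \<tau> = 0"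
    and "- a0 * R0 * pd1 P21 \<xi> \<tau> - 3 * \<gamma> * a0 * P20 * pd1 R1 \<xi> \<tau>
      + 3 * (\<gamma> - 1) * T0 * (P22 \<xi> \<tau> * R0^2 + 3 * P21 \<xi> \<tau> * R0 * R1 \<xi> \<tau>
          + 3 * P20 * (R0 * R2 \<xi> \<tau> + (R1 \<xi> \<tau>)\<^sup>2)) / (P20 * R0^2) = 0"
    and "e = (\<lambda>\<epsilon>. gm_at \<alpha> \<alpha> a0 \<epsilon> (E4 \<gamma> T0 P20 R0 (gm_pull \<alpha> \<alpha> a0 \<epsilon> (trunc2 \<alpha> \<alpha> \<epsilon> 0 u1 u2))
           (gm_pull \<alpha> \<alpha> a0 \<epsilon> (trunc2 \<alpha> \<alpha> \<epsilon> P20 P21 P22))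
           (gm_pull \<alpha> \<alpha> a0 \<epsilon> (trunc2 \<alpha> \<alpha> \<epsilon> R0 R1 R2))) \<xi> \<tau>)"
  shows "eps_coeffs_vanish \<alpha> e {\<alpha>, \<alpha> + \<alpha>} \<and> e \<in> O[at_right 0](\<lambda>\<epsilon>. \<epsilon> powr (3 * \<alpha>))"
proof -
  define M N where "M = material_poly a0 u1 u2 R1 R2 \<xi> \<tau>" and "N = material_poly a0 u1 u2 P21 P22 \<xi> \<tau>"
  let ?R = "[:R0, R1 \<xi> \<tau>, R2 \<xi> \<tau>:]" and ?P = "[:P20, P21 \<xi> \<tau>, P22 \<xi> \<tau>:]"
  define C where "C = smult (1 / (P20 * R0^3)) (?P * ?R^3) - 1"
  define p where "p = pCons 0 (pCons 0 (?R * N + smult (3 * \<gamma>) (?P * M))) + smult (3 * (\<gamma> - 1) * T0) C"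
  have "e \<epsilon> = poly p (\<epsilon> powr \<alpha>) / poly ?R (\<epsilon> powr \<alpha>)" if "\<epsilon> > 0" "poly ?R (\<epsilon> powr \<alpha>) \<noteq> 0" for \<epsilon>
  proof -
    define d where "d = \<epsilon> powr \<alpha>"
    define R P where "R = poly ?R d" and "P = poly ?P d"
    have Rnz: "R \<noteq> 0"
      unfolding R_def d_def by (rule that(2))
    have Cd: "poly C d = P * R^3 / (P20 * R0^3) - 1"
      unfolding C_def P_def R_def poly_smult poly_mult poly_power poly_diff poly_1 by simp
    have "e \<epsilon> = poly (pCons 0 (pCons 0 N)) d + 3 * \<gamma> * P * (poly (pCons 0 (pCons 0 M)) d / R)
      + 3 * (\<gamma> - 1) * (T0 / R) * (P * R^3 / (P20 * R0^3) - 1)"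
      unfolding assms(14) gm_at_E4[OF assms(2) smooth_strip_trunc2[OF assms(2-4)] smooth_strip_trunc2[OF assms(2,5,6)]
          smooth_strip_trunc2[OF assms(2,7,8)] that(1) assms(9)]
        gm_material_trunc2[OF assms(5,6,9) that(1)] gm_material_trunc2[OF assms(7-9) that(1)]
        trunc2_poly M_def N_def R_def P_def d_def ..
    also have "\<dots> = (R * poly (pCons 0 (pCons 0 N)) d + 3 * \<gamma> * P * poly (pCons 0 (pCons 0 M)) d
      + 3 * (\<gamma> - 1) * T0 * poly C d) / R"
      using Rnz unfolding Cd by (simp add: add_divide_distrib del: poly_pCons)
    also have "R * poly (pCons 0 (pCons 0 N)) d + 3 * \<gamma> * P * poly (pCons 0 (pCons 0 M)) d
      + 3 * (\<gamma> - 1) * T0 * poly C d = poly p d"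
      unfolding p_def R_def P_def poly_pCons poly_add poly_mult poly_0 poly_smult by algebra
    finally show ?thesis by (simp add: R_def d_def)
  qed
  moreover have "coeff p i = 0" if "i < 3" for i
  proof (rule low_coeffs_3[OF _ _ _ that])
    have MN: "coeff M 0 = - a0 * pd1 R1 \<xi> \<tau>" "coeff N 0 = - a0 * pd1 P21 \<xi> \<tau>"
      by (simp_all add: M_def N_def coeff_material_poly_0)
    have C: "coeff C 0 = 0" "coeff C 1 = (P21 \<xi> \<tau> * R0 + 3 * P20 * R1 \<xi> \<tau>) / (P20 * R0)"
      "coeff C 2 = (P22 \<xi> \<tau> * R0^2 + 3 * P21 \<xi> \<tau> * R0 * R1 \<xi> \<tau>
          + 3 * P20 * (R0 * R2 \<xi> \<tau> + (R1 \<xi> \<tau>)\<^sup>2)) / (P20 * R0^2)"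
      using assms(10,11)
      by (simp_all add: C_def power3_eq_cube power2_eq_square numeral_2_eq_2 field_simps one_pCons)
    show "coeff p 0 = 0" "coeff p 1 = 0" "coeff p 2 = 0"
      using assms(12,13) C MN unfolding p_def
      by (simp_all add: coeff_pCons numeral_2_eq_2 coeff_mult_0 algebra_simps)
  qed
  moreover have "coeff ?R 0 \<noteq> 0" using assms(10) by simp
  ultimately show ?thesis
    using eps_rational_vanish[OF assms(1) _ _ _ exponents_mem(2), of ?R e p] by auto
qed

lemma E5_trunc2_vanish:
  fixes r1 r2 R1 R2 :: field2
  assumes "\<alpha> > 0" "\<tau> \<in> J" "(1 - X + R0^3) * r0 = 1"
    and "(1 - X + R0^3) * r1 \<xi> \<tau> + 3 * R0^2 * R1 \<xi> \<tau> * r0 = 0"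
    and "(1 - X + R0^3) * r2 \<xi> \<tau> + 3 * R0^2 * R1 \<xi> \<tau> * r1 \<xi> \<tau>
      + 3 * (R0^2 * R2 \<xi> \<tau> + R0 * (R1 \<xi> \<tau>)\<^sup>2) * r0 = 0"
    and "e = (\<lambda>\<epsilon>. gm_at \<alpha> \<alpha> a0 \<epsilon> (E5 X (gm_pull \<alpha> \<alpha> a0 \<epsilon> (trunc2 \<alpha> \<alpha> \<epsilon> r0 r1 r2))
           (gm_pull \<alpha> \<alpha> a0 \<epsilon> (trunc2 \<alpha> \<alpha> \<epsilon> R0 R1 R2))) \<xi> \<tau>)"
  shows "eps_coeffs_vanish \<alpha> e {\<alpha>, \<alpha> + \<alpha>} \<and> e \<in> O[at_right 0](\<lambda>\<epsilon>. \<epsilon> powr (3 * \<alpha>))"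
proof -
  define p where "p = ([:1 - X:] + [:R0, R1 \<xi> \<tau>, R2 \<xi> \<tau>:]^3) * [:r0, r1 \<xi> \<tau>, r2 \<xi> \<tau>:] - 1"
  have "e \<epsilon> = poly p (\<epsilon> powr \<alpha>)" if "\<epsilon> > 0" for \<epsilon>
    unfolding assms(6) gm_at_E5[OF that assms(2)] trunc2_poly p_def by (simp add: algebra_simps)
  moreover have "coeff p i = 0" if "i < 3" for i
    using assms(3-5)
    by (intro low_coeffs_3[OF _ _ _ that])
       (simp_all add: p_def power3_eq_cube power2_eq_square numeral_2_eq_2 one_pCons algebra_simps)
  ultimately show ?thesis
    using eps_poly_vanish[OF assms(1) _ _ exponents_mem(2), of e p] by auto
qed

section \<open>Shape of the correction fields and solution of the coefficient equations\<close>

lemma smooth_strip_scale: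
  assumes "open J" "smooth_strip f J"
  shows "smooth_strip (\<lambda>\<xi> \<tau>. c * f \<xi> \<tau>) J"
  by (intro smooth_strip_mult smooth_strip_const assms)

lemma pd_scale:
  assumes "smooth_strip f J" "\<tau> \<in> J"
  shows "pd1 (\<lambda>\<xi> \<tau>. c * f \<xi> \<tau>) \<xi> \<tau> = c * pd1 f \<xi> \<tau>"
    and "pd2 (\<lambda>\<xi> \<tau>. c * f \<xi> \<tau>) \<xi> \<tau> = c * pd2 f \<xi> \<tau>"
    and "pd1 (pd1 (\<lambda>\<xi> \<tau>. c * f \<xi> \<tau>)) \<xi> \<tau> = c * pd1 (pd1 f) \<xi> \<tau>"
proof -
  have 1: "pd1 (\<lambda>\<xi> \<tau>. c * f \<xi> \<tau>) \<xi> \<tau> = c * pd1 f \<xi> \<tau>" if "smooth_strip f J" for f \<xi>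
    by (rule pd1_eqI, rule DERIV_cmult, rule smooth_strip_DERIV[OF that assms(2)])
  show "pd1 (\<lambda>\<xi> \<tau>. c * f \<xi> \<tau>) \<xi> \<tau> = c * pd1 f \<xi> \<tau>"
    by (rule 1[OF assms(1)])
  show "pd2 (\<lambda>\<xi> \<tau>. c * f \<xi> \<tau>) \<xi> \<tau> = c * pd2 f \<xi> \<tau>"
    by (rule pd2_eqI, rule DERIV_cmult, rule smooth_strip_DERIV[OF assms])
  have "pd1 (pd1 (\<lambda>\<xi> \<tau>. c * f \<xi> \<tau>)) \<xi> \<tau> = pd1 (\<lambda>\<xi> \<tau>. c * pd1 f \<xi> \<tau>) \<xi> \<tau>"
    by (rule pd1_cong_strip) (rule 1[OF assms(1)])
  then show "pd1 (pd1 (\<lambda>\<xi> \<tau>. c * f \<xi> \<tau>)) \<xi> \<tau> = c * pd1 (pd1 f) \<xi> \<tau>"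
    by (simp add: 1[OF smooth_strip_pd(1)[OF assms(1)]])
qed

text \<open>The outcome of integrating a delta^3 equation once in xi: the terms in rho1_xi_xi and
  rho1 rho1_xi become rho1_xi and half of rho1^2. The integration constants, functions of tau, are
  taken to be zero.\<close>

definition second_order :: "field2 \<Rightarrow> field2 \<Rightarrow> real \<Rightarrow> real \<Rightarrow> real \<Rightarrow> field2" where
  "second_order f g a b c = (\<lambda>\<xi> \<tau>. a * g \<xi> \<tau> + b * pd1 f \<xi> \<tau> + c * (f \<xi> \<tau>)\<^sup>2)"

lemma smooth_strip_second_order:
  assumes "open J" "smooth_strip f J" "smooth_strip g J"
  shows "smooth_strip (second_order f g a b c) J"
  unfolding second_order_def
  by (intro smooth_strip_add smooth_strip_mult smooth_strip_const smooth_strip_pd smooth_strip_power assms)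

lemma pd1_second_order:
  assumes "smooth_strip f J" "smooth_strip g J" "\<tau> \<in> J"
  shows "pd1 (second_order f g a b c) \<xi> \<tau> =
    a * pd1 g \<xi> \<tau> + b * pd1 (pd1 f) \<xi> \<tau> + 2 * c * f \<xi> \<tau> * pd1 f \<xi> \<tau>"
proof -
  note D = smooth_strip_DERIV(1)[OF assms(1,3)] smooth_strip_DERIV(1)[OF assms(2,3)]
    smooth_strip_DERIV(1)[OF smooth_strip_pd(1)[OF assms(1)] assms(3)]
  show ?thesis
    unfolding second_order_def by (rule pd1_eqI) (rule derivative_eq_intros D refl | simp)+
qed

theorem mainTheorem7:
  fixes \<alpha> \<beta> q k P0 R0 T0 \<sigma> \<gamma> X s \<rho>0 P20 a0 A B :: real
    and J :: "real set"
    and \<rho>1 \<rho>2 u1 R1 P21 P1 :: "real \<Rightarrow> real \<Rightarrow> real"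
  assumes "\<alpha> > 0" "\<beta> = \<alpha>" "q = \<alpha>" "k = \<alpha>"
    and "P0 > 0" "R0 > 0" "T0 > 0" "\<sigma> \<ge> 0" "\<gamma> > 1" "0 < X" "X < 1"
    and "s = R0^3 - X + 1" "\<rho>0 = 1 / s" "P20 = P0 + 2 * \<sigma> / R0"
    and "a0 = sqrt (9 * R0 * P0 + 12 * \<sigma>) * s / (3 * R0^2)"
    and "A = (P0^2 * R0^5 + R0^4 * (4 * P0 * \<sigma> + 13/3 * T0) + 4 * R0^3 * \<sigma>^2
              + ((P0 * R0 + 2 * \<sigma>)^2 + 4/3 * R0 * T0) * (1 - X)) * s / (6 * R0^4 * T0)"
    and "B = - sqrt 3 * (s^3 / (sqrt (3 * P0 * R0 + 4 * \<sigma>) * R0^5)) * (P0 * R0 + 14/9 * \<sigma>)"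
    and "open J" "is_interval J"
    and "smooth_strip \<rho>1 J"
    and "\<forall>\<xi>. \<forall>\<tau>\<in>J. pd2 \<rho>1 \<xi> \<tau> = A * pd1 (pd1 \<rho>1) \<xi> \<tau> + B * \<rho>1 \<xi> \<tau> * pd1 \<rho>1 \<xi> \<tau>"
    and "u1 = (\<lambda>\<xi> \<tau>. a0 / \<rho>0 * \<rho>1 \<xi> \<tau>)"
    and "R1 = (\<lambda>\<xi> \<tau>. - (s^2 / (3 * R0^2)) * \<rho>1 \<xi> \<tau>)"
    and "P21 = (\<lambda>\<xi> \<tau>. - (3 * (P0 * R0 + 2 * \<sigma>) / R0^2) * R1 \<xi> \<tau>)"
    and "P1 = (\<lambda>\<xi> \<tau>. P21 \<xi> \<tau> + 2 * \<sigma> / R0^2 * R1 \<xi> \<tau>)"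
    and "smooth_strip \<rho>2 J"
  shows "\<exists>u2 P2 P22 R2.
    smooth_strip u2 J \<and> smooth_strip P2 J \<and> smooth_strip P22 J \<and> smooth_strip R2 J \<and>
    (let rho = (\<lambda>\<epsilon>. gm_pull \<alpha> \<beta> a0 \<epsilon> (trunc2 q k \<epsilon> \<rho>0 \<rho>1 \<rho>2));
         u = (\<lambda>\<epsilon>. gm_pull \<alpha> \<beta> a0 \<epsilon> (trunc2 q k \<epsilon> 0 u1 u2));
         R = (\<lambda>\<epsilon>. gm_pull \<alpha> \<beta> a0 \<epsilon> (trunc2 q k \<epsilon> R0 R1 R2));
         P = (\<lambda>\<epsilon>. gm_pull \<alpha> \<beta> a0 \<epsilon> (trunc2 q k \<epsilon> P0 P1 P2));
         Pg = (\<lambda>\<epsilon>. gm_pull \<alpha> \<beta> a0 \<epsilon> (trunc2 q k \<epsilon> P20 P21 P22))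
     in \<forall>\<xi>. \<forall>\<tau>\<in>J.
       (let e1 = (\<lambda>\<epsilon>. gm_at \<alpha> \<beta> a0 \<epsilon> (E1 (rho \<epsilon>) (u \<epsilon>)) \<xi> \<tau>);
            e2 = (\<lambda>\<epsilon>. gm_at \<alpha> \<beta> a0 \<epsilon> (E2 (rho \<epsilon>) (u \<epsilon>) (P \<epsilon>)) \<xi> \<tau>);
            e3 = (\<lambda>\<epsilon>. gm_at \<alpha> \<beta> a0 \<epsilon> (E3 \<sigma> (u \<epsilon>) (P \<epsilon>) (Pg \<epsilon>) (R \<epsilon>)) \<xi> \<tau>);
            e4 = (\<lambda>\<epsilon>. gm_at \<alpha> \<beta> a0 \<epsilon> (E4 \<gamma> T0 P20 R0 (u \<epsilon>) (Pg \<epsilon>) (R \<epsilon>)) \<xi> \<tau>);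
            e5 = (\<lambda>\<epsilon>. gm_at \<alpha> \<beta> a0 \<epsilon> (E5 X (rho \<epsilon>) (R \<epsilon>)) \<xi> \<tau>)
        in (\<forall>e\<in>{e1, e2}. eps_coeffs_vanish \<alpha> e {\<alpha> + q, \<alpha> + q + k} \<and>
                         e \<in> O[at_right 0](\<lambda>\<epsilon>. \<epsilon> powr (4 * \<alpha>))) \<and>
           (\<forall>e\<in>{e3, e4, e5}. eps_coeffs_vanish \<alpha> e {q, q + k} \<and>
                         e \<in> O[at_right 0](\<lambda>\<epsilon>. \<epsilon> powr (3 * \<alpha>)))))"
proof -
  note eqs = assms(2-4)
  have s: "s > 0"
    using \<open>X < 1\<close> \<open>R0 > 0\<close> zero_less_power[of R0 3] unfolding \<open>s = R0^3 - X + 1\<close> by linarith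
  have P20: "P20 > 0" "P20 * R0 = P0 * R0 + 2 * \<sigma>"
    using assms(5-8) by (auto simp: \<open>P20 = P0 + 2 * \<sigma> / R0\<close> field_simps intro: add_pos_nonneg)
  have Q: "3 * P0 * R0 + 4 * \<sigma> > 0"
    using assms(5-8) by (simp add: add_pos_nonneg)
  have nz: "s \<noteq> 0" "R0 \<noteq> 0" "T0 \<noteq> 0" "P20 \<noteq> 0"
    using s assms(5-8) P20 by auto

  \<comment> \<open>The irrational factor shared by a0 and B: the root in a0 is
    \<open>sqrt 3 * S\<close>. Only a0^2 and the product of a0 and B enter the quadratic
    coefficients of E4, and both are free of roots.\<close>
  define S where "S = sqrt (3 * P0 * R0 + 4 * \<sigma>)"
  have S: "S > 0" "S * S = 3 * P0 * R0 + 4 * \<sigma>"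
    using Q by (auto simp: S_def)
  have a0_S: "a0 = sqrt 3 * S * s / (3 * R0^2)"
    unfolding assms(15) S_def real_sqrt_mult[symmetric] by (simp add: algebra_simps)
  have a0_sq: "a0^2 = (3 * P0 * R0 + 4 * \<sigma>) * s^2 / (3 * R0^4)"
    unfolding a0_S S(2)[symmetric] using nz by (simp add: power_divide power_mult_distrib field_simps power2_eq_square power4_eq_xxxx)
  have a0_B: "a0 * B = - (s^4 / R0^7) * (P0 * R0 + 14/9 * \<sigma>)"
  proof -
    \<comment> \<open>The root of 3 is replaced by a variable so that only its square is evaluated,
      after the cancellation of \<open>S\<close>.\<close>
    have "t * S * s / (3 * R0^2) * (- t * (s^3 / (S * R0^5)) * Z) = - (t * t / 3) * (s^4 / R0^7) * Z" for t Z
      using S nz by (simp add: field_simps eval_nat_numeral)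
    from this[of "sqrt 3"] show ?thesis
      unfolding a0_S assms(17) S_def[symmetric] by simp
  qed
  have two_A: "2 * A = s + 4 * s^2 / (9 * R0^3) + P20^2 * s^2 / (3 * R0^2 * T0)"
  proof -
    have X: "1 - X = s - R0^3"
      unfolding assms(12) by simp
    have "P0^2 * R0^5 + R0^4 * (4 * P0 * \<sigma> + 13/3 * T0) + 4 * R0^3 * \<sigma>^2
        + ((P0 * R0 + 2 * \<sigma>)^2 + 4/3 * R0 * T0) * (1 - X)
      = 3 * R0^4 * T0 + ((P20 * R0)^2 + 4/3 * R0 * T0) * s"
      unfolding X P20(2) by algebra
    then have "2 * A = 2 * ((3 * R0^4 * T0 + ((P20 * R0)^2 + 4/3 * R0 * T0) * s) * s / (6 * R0^4 * T0))"
      unfolding assms(16) by simp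
    also have "\<dots> = s + 4 * s^2 / (9 * R0^3) + P20^2 * s^2 / (3 * R0^2 * T0)"
      using nz by (simp add: field_simps power2_eq_square power3_eq_cube power4_eq_xxxx)
    finally show ?thesis .
  qed

  have P: "P20 = (P0 * R0 + 2 * \<sigma>) / R0"
    using P20(2) nz by (simp add: field_simps)
  \<comment> \<open>\<open>cr\<close> and \<open>cg\<close> are the ratios of R1 and P21 to rho1,
    forced by the linear parts of E5 and of E4. The identity \<open>cp\<close> is the sound speed
    relation: the pressure from linearized E3 equals the one that the momentum balance
    requires.\<close>
  define cr where "cr = - (s^2 / (3 * R0^2))"
  define cg where "cg = - (3 * P20 / R0) * cr"
  have cp: "cg + 2 * \<sigma> / R0^2 * cr = a0^2"
    unfolding a0_sq cg_def cr_def P using nz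
    by (simp add: field_simps power2_eq_square power4_eq_xxxx)
  have u1: "u1 = (\<lambda>\<xi> \<tau>. (a0 * s) * \<rho>1 \<xi> \<tau>)"
    unfolding assms(22,13) by simp
  have R1: "R1 = (\<lambda>\<xi> \<tau>. cr * \<rho>1 \<xi> \<tau>)"
    unfolding assms(23) cr_def ..
  have P21: "P21 = (\<lambda>\<xi> \<tau>. cg * \<rho>1 \<xi> \<tau>)"
    unfolding assms(24) R1 cg_def P20(2)[symmetric] using nz by (simp add: power2_eq_square mult.assoc)
  have P1: "P1 = (\<lambda>\<xi> \<tau>. a0^2 * \<rho>1 \<xi> \<tau>)"
    unfolding assms(25) P21 R1 cp[symmetric] by (simp add: algebra_simps)

  \<comment> \<open>This is \<open>- s * cr - cr^2 / R0\<close>, the coefficient of rho1^2 when the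
    delta^2 part of E5 is solved for R2. The coefficients \<open>aG\<close>, \<open>bG\<close>,
    \<open>cG\<close> come from the delta^2 part of E3 solved for P22.\<close>
  define cR where "cR = s^3 / (3 * R0^2) - s^4 / (9 * R0^5)"
  define aG where "aG = a0^2 - 2 * \<sigma> * cr / R0^2"
  define bG where "bG = a0 * (s - 2 * A) + 4 * a0 * s^2 / (9 * R0^3)"
  define cG where "cG = - (a0 * B) - a0^2 * s + 2 * \<sigma> * (s^4 / (9 * R0^7) - cR / R0^2)"
  define u2 where "u2 = second_order \<rho>1 \<rho>2 (a0 * s) (- A * s) (- (B / 2 + a0 * s) * s)"
  \<comment> \<open>The full 2 A and B, against A and B / 2 in \<open>u2\<close>, arise because
    rho1_tau enters E2 twice, directly through u1_tau and again through u2.\<close>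
  define P2 where "P2 = second_order \<rho>1 \<rho>2 (a0^2) (a0 * (s - 2 * A)) (- (a0 * B) - a0^2 * s)"
  define P22 where "P22 = second_order \<rho>1 \<rho>2 aG bG cG"
  define R2 where "R2 = second_order \<rho>1 \<rho>2 cr 0 cR"

  \<comment> \<open>The terms in rho2 obey the same linear relations as rho1, which is why rho2
    stays arbitrary. The next two identities are the conditions on A and on B.\<close>
  have aG: "aG = cg"
    unfolding aG_def cp[symmetric] by simp
  have bG: "T0 * bG = a0 * P20^2 * cr"
    unfolding bG_def two_A cr_def using nz by (simp add: field_simps power2_eq_square)
  have cG: "cG * R0^2 + 3 * cg * R0 * cr + 3 * P20 * (R0 * cR + cr^2) = 0"
    unfolding cG_def a0_B a0_sq cg_def cr_def cR_def P using nz
    by (simp add: field_simps eval_nat_numeral)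

  note open_J = \<open>open J\<close> and sm = \<open>smooth_strip \<rho>1 J\<close> \<open>smooth_strip \<rho>2 J\<close>
  have sm1: "smooth_strip u1 J" "smooth_strip R1 J" "smooth_strip P21 J" "smooth_strip P1 J"
    unfolding u1 R1 P21 P1 by (rule smooth_strip_scale[OF open_J sm(1)])+
  have sm2: "smooth_strip u2 J" "smooth_strip R2 J" "smooth_strip P22 J" "smooth_strip P2 J"
    unfolding u2_def R2_def P22_def P2_def by (rule smooth_strip_second_order[OF open_J sm])+

  have P0_P20: "P0 - P20 = - (2 * \<sigma> / R0)"
    unfolding assms(14) by simp
  have cgR: "cg * R0 = - 3 * P20 * cr"
    unfolding cg_def using nz by simp
  have X: "1 - X + R0^3 = s"
    unfolding assms(12) by simp

  show ?thesis
    unfolding eqs Let_def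
  proof (rule exI[of _ u2], rule exI[of _ P2], rule exI[of _ P22], rule exI[of _ R2],
      intro conjI sm2, intro allI ballI, goal_cases)
    case (1 \<xi> \<tau>)
    note pd = pd_scale[OF sm(1) 1] pd1_second_order[OF sm 1]
    have burgers: "pd2 \<rho>1 \<xi> \<tau> = A * pd1 (pd1 \<rho>1) \<xi> \<tau> + B * \<rho>1 \<xi> \<tau> * pd1 \<rho>1 \<xi> \<tau>"
      using assms(21) 1 by blast
    note E1 = E1_trunc2_vanish[OF assms(1) open_J sm sm1(1) sm2(1) 1 _ _ refl]
      and E2 = E2_trunc2_vanish[OF assms(1) open_J sm sm1(1) sm2(1) sm1(4) sm2(4) 1 _ _ refl]
      and E3 = E3_trunc2_vanish[OF assms(1) open_J sm1(1) sm2(1) sm1(2) sm2(2) 1 nz(2) _ _ _ refl]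
      and E4 = E4_trunc2_vanish[OF assms(1) open_J sm1(1) sm2(1) sm1(3) sm2(3) sm1(2) sm2(2) 1 nz(2,4) _ _ refl]
      and E5 = E5_trunc2_vanish[OF assms(1) 1 _ _ _ refl]

    have E1_2: "- a0 * pd1 \<rho>1 \<xi> \<tau> + \<rho>0 * pd1 u1 \<xi> \<tau> = 0"
      unfolding u1 pd assms(13) using nz by simp
    have E1_3: "pd2 \<rho>1 \<xi> \<tau> - a0 * pd1 \<rho>2 \<xi> \<tau> + u1 \<xi> \<tau> * pd1 \<rho>1 \<xi> \<tau> + \<rho>0 * pd1 u2 \<xi> \<tau>
        + \<rho>1 \<xi> \<tau> * pd1 u1 \<xi> \<tau> = 0"
      unfolding u1 u2_def pd assms(13) burgers using nz by (simp add: field_simps)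
    have E2_2: "pd1 P1 \<xi> \<tau> - a0 * \<rho>0 * pd1 u1 \<xi> \<tau> = 0"
      unfolding u1 P1 pd assms(13) using nz by (simp add: power2_eq_square)
    have E2_3: "\<rho>0 * pd2 u1 \<xi> \<tau>
        - a0 * (pd1 \<rho>1 \<xi> \<tau> * u1 \<xi> \<tau> + \<rho>0 * pd1 u2 \<xi> \<tau> + \<rho>1 \<xi> \<tau> * pd1 u1 \<xi> \<tau>)
        + 2 * \<rho>0 * u1 \<xi> \<tau> * pd1 u1 \<xi> \<tau> + pd1 P2 \<xi> \<tau> - pd1 (pd1 u1) \<xi> \<tau> = 0"
      unfolding u1 u2_def P2_def pd assms(13) burgers using nz by (simp add: field_simps power2_eq_square)
    have E3_0: "R0 * (P0 - P20) + 2 * \<sigma> = 0"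
      unfolding P0_P20 using nz by simp
    have E3_1: "R0 * (P1 \<xi> \<tau> - P21 \<xi> \<tau>) + R1 \<xi> \<tau> * (P0 - P20) = 0"
      unfolding P1 P21 R1 P0_P20 cp[symmetric] using nz by (simp add: field_simps power2_eq_square)
    have E3_2: "R0 * (P2 \<xi> \<tau> - P22 \<xi> \<tau>) + R1 \<xi> \<tau> * (P1 \<xi> \<tau> - P21 \<xi> \<tau>) + R2 \<xi> \<tau> * (P0 - P20)
        - 4/3 * a0 * pd1 R1 \<xi> \<tau> = 0"
    proof -
      have P1_P21: "P1 \<xi> \<tau> - P21 \<xi> \<tau> = 2 * \<sigma> / R0^2 * (cr * \<rho>1 \<xi> \<tau>)"
        unfolding P1 P21 R1 cp[symmetric] by (simp add: algebra_simps)
      show ?thesis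
        unfolding P1_P21 P2_def P22_def R2_def R1 pd P0_P20 second_order_def aG_def bG_def cG_def cr_def
        using nz by (simp add: field_simps eval_nat_numeral)
    qed
    have E4_1: "P21 \<xi> \<tau> * R0 + 3 * P20 * R1 \<xi> \<tau> = 0"
      unfolding P21 R1 using cgR by algebra
    have E4_2: "- a0 * R0 * pd1 P21 \<xi> \<tau> - 3 * \<gamma> * a0 * P20 * pd1 R1 \<xi> \<tau>
        + 3 * (\<gamma> - 1) * T0 * (P22 \<xi> \<tau> * R0^2 + 3 * P21 \<xi> \<tau> * R0 * R1 \<xi> \<tau>
          + 3 * P20 * (R0 * R2 \<xi> \<tau> + (R1 \<xi> \<tau>)\<^sup>2)) / (P20 * R0^2) = 0"
    proof -
      have "P22 \<xi> \<tau> * R0^2 + 3 * P21 \<xi> \<tau> * R0 * R1 \<xi> \<tau> + 3 * P20 * (R0 * R2 \<xi> \<tau> + (R1 \<xi> \<tau>)\<^sup>2)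
          = bG * R0^2 * pd1 \<rho>1 \<xi> \<tau>"
        \<comment> \<open>\<open>cgR\<close> removes the terms in rho2 and \<open>cG\<close> those
          in rho1^2; only the dissipative part with \<open>bG\<close> survives.\<close>
        unfolding P22_def R2_def P21 R1 second_order_def aG using cgR cG by algebra
      then have "3 * (\<gamma> - 1) * T0 * (P22 \<xi> \<tau> * R0^2 + 3 * P21 \<xi> \<tau> * R0 * R1 \<xi> \<tau>
          + 3 * P20 * (R0 * R2 \<xi> \<tau> + (R1 \<xi> \<tau>)\<^sup>2)) / (P20 * R0^2)
          = 3 * (\<gamma> - 1) * (T0 * bG) * pd1 \<rho>1 \<xi> \<tau> / P20"
        using nz by simp
      also have "\<dots> = 3 * (\<gamma> - 1) * a0 * P20 * cr * pd1 \<rho>1 \<xi> \<tau>"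
        unfolding bG using nz by (simp add: power2_eq_square)
      finally show ?thesis
        \<comment> \<open>By \<open>cgR\<close> the two transport terms combine to
          \<open>- 3 * (\<gamma> - 1) * a0 * P20 * cr\<close> times rho1_xi, the opposite of the
          heat term.\<close>
        unfolding P21 R1 pd using cgR by algebra
    qed
    have E5_0: "(1 - X + R0^3) * \<rho>0 = 1"
      unfolding X assms(13) using nz by simp
    have E5_1: "(1 - X + R0^3) * \<rho>1 \<xi> \<tau> + 3 * R0^2 * R1 \<xi> \<tau> * \<rho>0 = 0"
      unfolding X assms(13) R1 cr_def using nz by (simp add: field_simps power2_eq_square)
    have E5_2: "(1 - X + R0^3) * \<rho>2 \<xi> \<tau> + 3 * R0^2 * R1 \<xi> \<tau> * \<rho>1 \<xi> \<tau>
        + 3 * (R0^2 * R2 \<xi> \<tau> + R0 * (R1 \<xi> \<tau>)\<^sup>2) * \<rho>0 = 0"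
      unfolding X assms(13) R1 R2_def second_order_def cr_def cR_def
      using nz by (simp add: field_simps eval_nat_numeral)
    show ?case
      unfolding ball_simps simp_thms
      by (rule E1 E2 E3 E4 E5 E1_2 E1_3 E2_2 E2_3 E3_0 E3_1 E3_2 E4_1 E4_2 E5_0 E5_1 E5_2 conjI)+
  qed
qed

end
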